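(* Let $s,m\in\mathbb N$, let $\mathcal I_m$ be the set of nonsingular $m\times m$ matrices over $\mathbb F_2$, and let generating matrices $\mathcal C_1,\dots,\mathcal C_s$ be drawn independently from the uniform distribution on $\mathcal I_m$. Consider random linear scrambling based on these generating matrices, and let $R_{m,r}$ ($r\in\mathbb N$) be its $r$-way rank deficiency (a random variable, being a function of $\mathcal C_1,\dots,\mathcal C_s$). Then $$\Pr\big(R_{m,1}\ge3s\log_2(m+1)\big)\le\frac{\exp(2s)}{(m+1)^{2s}},$$ and for every $r\ge2$, $$\Pr\Big(R_{m,r}\ge\max\big(R_{m,r-1},(2^r+2r-1)s\log_2(m+1)\big)\Big)\le\frac{\exp(2sr)}{(m+1)^{2sr}}.$$
   Context: Random linear scrambling with fixed generating matrices $\mathcal C_j\in\{0,1\}^{m\times m}$: $C_j=M_j\mathcal C_j\bmod2$, where $M_1,\dots,M_s\in\{0,1\}^{\infty\times m}$ are independent random lower-triangular matrices: $M_j(\ell,\ell)=1$ for $\ell\le m$, $M_j(\ell,\ell')=0$ for $\ell<\ell'$, and all entries with $\ell>\ell'$ i.i.d. uniform on $\{0,1\}$. For $k\in\mathbb N_0$, $k=\sum_{\ell\ge1}a_\ell2^{\ell-1}$, let $\kappa=\{\ell:a_\ell=1\}$; for $\boldsymbol k=(k_1,\dots,k_s)\in\mathbb N_0^s$ with digit sets $\kappa_1,\dots,\kappa_s$, $Z(\boldsymbol k)=\mathbf 1\{\sum_{j=1}^s\sum_{\ell\in\kappa_j}C_j(\ell,:)=\boldsymbol0\bmod2\}$.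 $\oplus$ on $\mathbb N_0^s$ is componentwise bitwise XOR, making $\mathbb N_0^s$ an $\mathbb F_2$-vector space; the rank of a finite subset is its $\mathbb F_2$-rank. With $\mathbb N_*^s=\mathbb N_0^s\setminus\{\boldsymbol0\}$ and $\mathbb V_r=\{V\subseteq\mathbb N_*^s:|V|=\mathrm{rank}(V)=r\}$, the $r$-way rank deficiency is $R_{m,r}=mr+\sup_{V\in\mathbb V_r}\log_2\Pr(Z(\boldsymbol k)=1\text{ for all }\boldsymbol k\in V\mid\mathcal C_1,\dots,\mathcal C_s)$, the probability being over the $M_j$. *)

theory Defs
  imports "HOL-Probability.Probability"
begin

definition digits :: "nat \<Rightarrow> nat set" where
  "digits k = {l. 1 \<le> l \<and> bit k (l - 1)}"

definition kvecs :: "nat \<Rightarrow> (nat \<Rightarrow> nat) set" where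
  "kvecs s = {k. \<forall>j. j \<notin> {1..s} \<longrightarrow> k j = 0}"

definition kvecs_star :: "nat \<Rightarrow> (nat \<Rightarrow> nat) set" where
  "kvecs_star s = kvecs s - {(\<lambda>_. 0)}"

definition xor_sum :: "(nat \<Rightarrow> nat) set \<Rightarrow> (nat \<Rightarrow> nat)" where
  "xor_sum W = Finite_Set.fold (\<lambda>k acc j. xor (k j) (acc j)) (\<lambda>_. 0) W"

definition f2_indep :: "(nat \<Rightarrow> nat) set \<Rightarrow> bool" where
  "f2_indep W \<longleftrightarrow> finite W \<and> (\<forall>U\<subseteq>W. U \<noteq> {} \<longrightarrow> xor_sum U \<noteq> (\<lambda>_. 0))"

definition f2_rank :: "(nat \<Rightarrow> nat) set \<Rightarrow> nat" where
  "f2_rank V = Max {card W | W. W \<subseteq> V \<and> f2_indep W}"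

definition Vr :: "nat \<Rightarrow> nat \<Rightarrow> (nat \<Rightarrow> nat) set set" where
  "Vr s r = {V. V \<subseteq> kvecs_star s \<and> finite V \<and> card V = r \<and> f2_rank V = r}"

definition coin_space :: "(nat \<times> nat \<times> nat \<Rightarrow> bool) measure" where
  "coin_space = PiM UNIV (\<lambda>_. measure_pmf (bernoulli_pmf (1/2)))"

text \<open>Entry M_j(l,l') (1-based, l >= 1, 1 <= l' <= m): 1 on the diagonal, 0 above it,
  an independent fair bit below it.\<close>
definition Ment :: "(nat \<times> nat \<times> nat \<Rightarrow> bool) \<Rightarrow> nat \<Rightarrow> nat \<Rightarrow> nat \<Rightarrow> nat" where
  "Ment \<omega> j l l' = (if l = l' then 1 else if l < l' then 0 else of_bool (\<omega> (j, l, l')))"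

text \<open>Z(k) for generating matrices Cg j (entries Cg j row col, 1-based): the F_2-sum of the
  rows l in kappa_j of C_j = M_j Cg_j (mod 2), over j = 1..s, is zero.\<close>
definition Zev :: "nat \<Rightarrow> nat \<Rightarrow> (nat \<Rightarrow> nat \<Rightarrow> nat \<Rightarrow> nat) \<Rightarrow> (nat \<times> nat \<times> nat \<Rightarrow> bool)
    \<Rightarrow> (nat \<Rightarrow> nat) \<Rightarrow> bool" where
  "Zev s m Cg \<omega> k \<longleftrightarrow>
     (\<forall>c\<in>{1..m}. even (\<Sum>j\<in>{1..s}. \<Sum>l\<in>digits (k j). \<Sum>l'\<in>{1..m}. Ment \<omega> j l l' * Cg j l' c))"

definition Pr_all :: "nat \<Rightarrow> nat \<Rightarrow> (nat \<Rightarrow> nat \<Rightarrow> nat \<Rightarrow> nat) \<Rightarrow> (nat \<Rightarrow> nat) set \<Rightarrow> real" where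
  "Pr_all s m Cg V = measure coin_space {\<omega> \<in> space coin_space. \<forall>k\<in>V. Zev s m Cg \<omega> k}"

definition elog2 :: "real \<Rightarrow> ereal" where
  "elog2 p = (if p = 0 then -\<infinity> else ereal (log 2 p))"

definition rank_def :: "nat \<Rightarrow> nat \<Rightarrow> nat \<Rightarrow> (nat \<Rightarrow> nat \<Rightarrow> nat \<Rightarrow> nat) \<Rightarrow> ereal" where
  "rank_def s m r Cg = ereal (real (m * r)) + (SUP V\<in>Vr s r. elog2 (Pr_all s m Cg V))"

definition f2_mat :: "nat \<Rightarrow> (nat \<Rightarrow> nat \<Rightarrow> nat) \<Rightarrow> bool" where
  "f2_mat m D \<longleftrightarrow> (\<forall>i c. D i c \<in> {0, 1}) \<and> (\<forall>i c. (i \<notin> {1..m} \<or> c \<notin> {1..m}) \<longrightarrow> D i c = 0)"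

definition f2_nonsingular :: "nat \<Rightarrow> (nat \<Rightarrow> nat \<Rightarrow> nat) \<Rightarrow> bool" where
  "f2_nonsingular m D \<longleftrightarrow> f2_mat m D \<and> (\<exists>E. f2_mat m E \<and>
     (\<forall>i\<in>{1..m}. \<forall>c\<in>{1..m}. (\<Sum>l\<in>{1..m}. D i l * E l c) mod 2 = (if i = c then 1 else 0)) \<and>
     (\<forall>i\<in>{1..m}. \<forall>c\<in>{1..m}. (\<Sum>l\<in>{1..m}. E i l * D l c) mod 2 = (if i = c then 1 else 0)))"

definition gen_tuples :: "nat \<Rightarrow> nat \<Rightarrow> (nat \<Rightarrow> nat \<Rightarrow> nat \<Rightarrow> nat) set" where
  "gen_tuples s m = {Cg. (\<forall>j\<in>{1..s}. f2_nonsingular m (Cg j)) \<and> (\<forall>j. j \<notin> {1..s} \<longrightarrow> Cg j = (\<lambda>_ _. 0))}"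

end

theory Submission
  imports Defs "HOL-Library.Z2"
begin

text \<open>
  The event of the second claim is contained in the event that the \<open>r\<close>-way rank deficiency reaches
  the explicit threshold, so the recursion on \<open>r\<close> can be ignored and all cases are treated alike.

  Expanding the probability that \<open>r\<close> given events occur into characters of the field with two
  elements shows two things. A digit in a row \<open>l > m\<close> meets a full vector of free bits; since
  \<open>C\<^sub>j\<close> is nonsingular, it forces a linear relation between the dual variables, and one index can be
  eliminated at the cost of a factor \<open>2\<^sup>-\<^sup>m\<close>. Once all digits are at most \<open>m\<close>, the probability depends
  on the digits only through the last row \<open>l\<close>, for each \<open>j\<close> and each nonempty set \<open>u\<close> of indices, in
  which exactly the indices of \<open>u\<close> have a digit. Hence at most \<open>(m + 1) ^ (s (2\<^sup>r - 1))\<close> different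
  functions of the generating matrices occur.

  Averaged over all tuples of matrices, each of these functions equals \<open>2 ^ (- m r)\<close>, because the
  scrambling matrices are unit triangular and the indices independent. At least a quarter of all
  matrices are nonsingular, so the average over nonsingular tuples is at most \<open>4\<^sup>s\<close> times as large.
  Markov's inequality and the union bound finish the proof.
\<close>

text \<open>The library rewrites sums and products of bits into bit operations, and \<open>1\<close>
  into \<open>Suc 0\<close>. Without these rules, ring normalisation applies to bit sums and the
  1-based ranges keep their form.\<close>

declare add_bit_eq_xor [simp del] mult_bit_eq_and [simp del] One_nat_def [simp del]

subsection \<open>Linear systems over the field with two elements\<close>

abbreviation cube :: "'a set \<Rightarrow> ('a \<Rightarrow> bit) set" where
  "cube X \<equiv> PiE X (\<lambda>_. UNIV)"

lemma UNIV_bit: "(UNIV :: bit set) = {0, 1}"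
  by (auto intro: bit.exhaust)

lemma finite_UNIV_bit [simp]: "finite (UNIV :: bit set)"
  by (simp add: UNIV_bit)

lemma card_UNIV_bit [simp]: "card (UNIV :: bit set) = 2"
  by (simp add: UNIV_bit)

lemma finite_cube [simp]: "finite X \<Longrightarrow> finite (cube X)"
  by (intro finite_PiE) auto

lemma card_cube [simp]: "finite X \<Longrightarrow> card (cube X) = 2 ^ card X"
  by (simp add: card_PiE)

lemma of_nat_bit_eq_0_iff: "(of_nat n :: bit) = 0 \<longleftrightarrow> even n"
  by (induction n) auto

lemma one_add_one_bit [simp]: "1 + 1 = (0 :: bit)"
  by (metis bit_2_eq_0 one_add_one)

lemma add_bit_self [simp]: "b + b = (0 :: bit)"
  by (cases b) auto

lemma add_bit_eq_0_iff: "b + c = 0 \<longleftrightarrow> b = (c :: bit)"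
  by (cases b; cases c) auto

text \<open>The nontrivial additive character of the field with two elements, with real
  values.\<close>

definition chi :: "bit \<Rightarrow> real" where
  "chi b = (if b = 0 then 1 else -1)"

lemma chi_0 [simp]: "chi 0 = 1"
  by (simp add: chi_def)

lemma chi_add: "chi (b + c) = chi b * chi c"
  by (cases b; cases c) (auto simp: chi_def)

lemma chi_sum: "chi (\<Sum>x\<in>X. f x) = (\<Prod>x\<in>X. chi (f x))"
  by (induction X rule: infinite_finite_induct) (auto simp: chi_add)

lemma sum_chi_mult: "(\<Sum>c\<in>UNIV. chi (b * c)) = (if b = 0 then 2 else 0)"
  by (simp add: UNIV_bit chi_def)

text \<open>Orthogonality of characters: the sum factors over the coordinates, and any coordinate
  with \<open>b x = 1\<close> contributes \<open>1 - 1 = 0\<close>.\<close>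

lemma sum_chi_linear_form:
  assumes "finite X"
  shows "(\<Sum>v\<in>cube X. chi (\<Sum>x\<in>X. b x * v x)) = (if \<forall>x\<in>X. b x = 0 then 2 ^ card X else 0)"
proof -
  have "(\<Sum>v\<in>cube X. chi (\<Sum>x\<in>X. b x * v x)) = (\<Prod>x\<in>X. \<Sum>c\<in>UNIV. chi (b x * c))"
    using assms by (subst prod_sum_PiE) (auto simp: chi_sum)
  also have "\<dots> = (if \<forall>x\<in>X. b x = 0 then 2 ^ card X else 0)"
    using assms by (auto simp: sum_chi_mult)
  finally show ?thesis .
qed

text \<open>The indicator of the system is an average of characters over dual variables
  \<open>y\<close>, one per equation. After swapping the sums, orthogonality in \<open>v\<close>
  keeps only those \<open>y\<close> in the left kernel of \<open>B\<close>.\<close>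

lemma card_linear_solutions:
  assumes X: "finite X" and E: "finite E"
  shows "2 ^ card E * real (card {v \<in> cube X. \<forall>e\<in>E. (\<Sum>x\<in>X. B e x * v x) = t e}) =
    2 ^ card X * (\<Sum>y\<in>cube E. if \<forall>x\<in>X. (\<Sum>e\<in>E. y e * B e x) = 0
                               then chi (\<Sum>e\<in>E. y e * t e) else 0)"
proof -
  define S where "S = {v \<in> cube X. \<forall>e\<in>E. (\<Sum>x\<in>X. B e x * v x) = t e}"
  \<comment> \<open>In characteristic two, an equation holds iff the sum of its two sides vanishes,
    which is what the dual variable detects.\<close>
  have ind: "(\<Sum>y\<in>cube E. chi (\<Sum>e\<in>E. ((\<Sum>x\<in>X. B e x * v x) + t e) * y e)) =
      (if v \<in> S then 2 ^ card E else 0)" if "v \<in> cube X" for v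
    using that by (subst sum_chi_linear_form[OF E]) (auto simp: S_def add_bit_eq_0_iff)
  have "2 ^ card E * real (card S) = (\<Sum>v\<in>cube X. if v \<in> S then 2 ^ card E else 0)"
    using X by (subst sum.If_cases) (auto simp: S_def Int_def mult.commute intro!: arg_cong[where f=card])
  also have "\<dots> = (\<Sum>v\<in>cube X. \<Sum>y\<in>cube E. chi (\<Sum>e\<in>E. ((\<Sum>x\<in>X. B e x * v x) + t e) * y e))"
    using ind by (intro sum.cong) auto
  also have "\<dots> = (\<Sum>y\<in>cube E. \<Sum>v\<in>cube X. chi (\<Sum>e\<in>E. ((\<Sum>x\<in>X. B e x * v x) + t e) * y e))"
    by (rule sum.swap)
  also have "\<dots> = (\<Sum>y\<in>cube E. \<Sum>v\<in>cube X.
      chi (\<Sum>e\<in>E. y e * t e) * chi (\<Sum>x\<in>X. (\<Sum>e\<in>E. y e * B e x) * v x))"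
  proof (intro sum.cong refl)
    fix y v
    have "(\<Sum>e\<in>E. ((\<Sum>x\<in>X. B e x * v x) + t e) * y e) =
        (\<Sum>e\<in>E. y e * t e) + (\<Sum>e\<in>E. \<Sum>x\<in>X. y e * B e x * v x)"
      by (simp add: algebra_simps sum.distrib sum_distrib_left)
    also have "(\<Sum>e\<in>E. \<Sum>x\<in>X. y e * B e x * v x) = (\<Sum>x\<in>X. (\<Sum>e\<in>E. y e * B e x) * v x)"
      by (subst sum.swap) (simp add: sum_distrib_right)
    finally show "chi (\<Sum>e\<in>E. ((\<Sum>x\<in>X. B e x * v x) + t e) * y e) =
        chi (\<Sum>e\<in>E. y e * t e) * chi (\<Sum>x\<in>X. (\<Sum>e\<in>E. y e * B e x) * v x)"
      by (simp add: chi_add)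
  qed
  also have "\<dots> = (\<Sum>y\<in>cube E. chi (\<Sum>e\<in>E. y e * t e) *
      (if \<forall>x\<in>X. (\<Sum>e\<in>E. y e * B e x) = 0 then 2 ^ card X else 0))"
    by (simp only: sum_distrib_left[symmetric] sum_chi_linear_form[OF X])
  also have "\<dots> = 2 ^ card X * (\<Sum>y\<in>cube E. if \<forall>x\<in>X. (\<Sum>e\<in>E. y e * B e x) = 0
                               then chi (\<Sum>e\<in>E. y e * t e) else 0)"
    unfolding sum_distrib_left by (intro sum.cong) auto
  finally show ?thesis by (simp add: S_def)
qed

text \<open>The hypothesis \<open>inj\<close> says that the rows of \<open>B\<close> are
  independent. Then only the zero dual vector survives, and the count is the same for every
  right-hand side \<open>t\<close>.\<close>

lemma card_linear_solutions_full_rank: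
  assumes X: "finite X" and E: "finite E"
    and inj: "\<And>y e. \<lbrakk>\<forall>x\<in>X. (\<Sum>e\<in>E. y e * B e x) = 0; e \<in> E\<rbrakk> \<Longrightarrow> y e = 0"
  shows "2 ^ card E * real (card {v \<in> cube X. \<forall>e\<in>E. (\<Sum>x\<in>X. B e x * v x) = t e}) = 2 ^ card X"
proof -
  let ?o = "\<lambda>e\<in>E. 0 :: bit"
  have "(\<Sum>y\<in>cube E. if \<forall>x\<in>X. (\<Sum>e\<in>E. y e * B e x) = 0 then chi (\<Sum>e\<in>E. y e * t e) else 0) =
     (\<Sum>y\<in>{?o}. if \<forall>x\<in>X. (\<Sum>e\<in>E. y e * B e x) = 0 then chi (\<Sum>e\<in>E. y e * t e) else 0)"
  proof (rule sum.mono_neutral_right)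
    show "\<forall>y\<in>cube E - {?o}. (if \<forall>x\<in>X. (\<Sum>e\<in>E. y e * B e x) = 0
            then chi (\<Sum>e\<in>E. y e * t e) else 0) = 0"
    proof
      fix y assume y: "y \<in> cube E - {?o}"
      have "\<not> (\<forall>x\<in>X. (\<Sum>e\<in>E. y e * B e x) = 0)"
      proof
        assume "\<forall>x\<in>X. (\<Sum>e\<in>E. y e * B e x) = 0"
        then have "y e = ?o e" for e
          using inj[of y e] y by (cases "e \<in> E") (auto simp: PiE_def extensional_def)
        then show False using y by auto
      qed
      then show "(if \<forall>x\<in>X. (\<Sum>e\<in>E. y e * B e x) = 0
            then chi (\<Sum>e\<in>E. y e * t e) else 0) = 0" by (rule if_not_P)
    qed
  qed (use E in auto)
  also have "\<dots> = 1" by simp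
  finally show ?thesis by (simp add: card_linear_solutions[OF X E])
qed

subsection \<open>Coin tosses\<close>

lemma coin_prob_cylinder:
  assumes "finite X"
  shows "measure coin_space {\<omega> \<in> space coin_space. \<forall>x\<in>X. \<omega> x = v x} = (1/2) ^ card X"
    and "{\<omega> \<in> space coin_space. \<forall>x\<in>X. \<omega> x = v x} \<in> sets coin_space"
proof -
  interpret product_prob_space "\<lambda>_::nat\<times>nat\<times>nat. measure_pmf (bernoulli_pmf (1/2))" UNIV
    by unfold_locales
  have eq: "{\<omega> \<in> space coin_space. \<forall>x\<in>X. \<omega> x = v x} =
     prod_emb UNIV (\<lambda>_. measure_pmf (bernoulli_pmf (1/2))) X (PiE X (\<lambda>x. {v x}))"
    by (auto simp: coin_space_def prod_emb_def space_PiM PiE_def restrict_def extensional_def Pi_def)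
  have "emeasure (measure_pmf (bernoulli_pmf (1/2))) {b} = ennreal (1/2)" for b
    by (cases b) (simp_all add: emeasure_pmf_single)
  then have "emeasure coin_space {\<omega> \<in> space coin_space. \<forall>x\<in>X. \<omega> x = v x} = ennreal (1/2) ^ card X"
    unfolding eq unfolding coin_space_def using assms by (subst emeasure_PiM_emb) auto
  then show "measure coin_space {\<omega> \<in> space coin_space. \<forall>x\<in>X. \<omega> x = v x} = (1/2) ^ card X"
    by (simp add: measure_def ennreal_power del: ennreal_half)
  show "{\<omega> \<in> space coin_space. \<forall>x\<in>X. \<omega> x = v x} \<in> sets coin_space"
    unfolding eq unfolding coin_space_def using assms by (intro sets_PiM_I) auto
qed

text \<open>An event determined by the coins in \<open>X\<close> is a finite disjoint union of
  cylinders of probability \<open>2 ^ (- card X)\<close>, so its probability is a count of bit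
  vectors.\<close>

lemma coin_prob_eq:
  assumes X: "finite X"
    and P: "\<And>\<omega>. P \<omega> \<longleftrightarrow> R (\<lambda>x\<in>X. of_bool (\<omega> x))"
  shows "measure coin_space {\<omega> \<in> space coin_space. P \<omega>} =
    real (card {v \<in> cube X. R v}) / 2 ^ card X"
proof -
  interpret prob_space coin_space
    unfolding coin_space_def by (intro prob_space_PiM prob_space_measure_pmf)
  define S where "S = {v \<in> cube X. R v}"
  define cyl where "cyl v = {\<omega> \<in> space coin_space. \<forall>x\<in>X. \<omega> x = (v x = (1::bit))}" for v
  have fin: "finite S" using X by (simp add: S_def)
  have "{\<omega> \<in> space coin_space. P \<omega>} = (\<Union>v\<in>S. cyl v)"
  proof (intro equalityI subsetI)
    fix \<omega> assume "\<omega> \<in> {\<omega> \<in> space coin_space. P \<omega>}"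
    then have "(\<lambda>x\<in>X. of_bool (\<omega> x)) \<in> S" "\<omega> \<in> cyl (\<lambda>x\<in>X. of_bool (\<omega> x))"
      by (auto simp: S_def P cyl_def)
    then show "\<omega> \<in> (\<Union>v\<in>S. cyl v)" by blast
  next
    fix \<omega> assume "\<omega> \<in> (\<Union>v\<in>S. cyl v)"
    then obtain v where v: "v \<in> S" "\<omega> \<in> cyl v" by blast
    then have "(\<lambda>x\<in>X. of_bool (\<omega> x)) = v"
      by (auto simp: cyl_def S_def PiE_def extensional_def fun_eq_iff)
    with v show "\<omega> \<in> {\<omega> \<in> space coin_space. P \<omega>}" by (auto simp: P S_def cyl_def)
  qed
  moreover have "measure coin_space (\<Union>v\<in>S. cyl v) = (\<Sum>v\<in>S. measure coin_space (cyl v))"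
  proof (rule finite_measure_finite_Union[OF fin])
    show "cyl ` S \<subseteq> sets coin_space"
      using coin_prob_cylinder(2)[OF X] by (auto simp: cyl_def)
    show "disjoint_family_on cyl S"
    proof (unfold disjoint_family_on_def, intro ballI impI)
      fix v w assume vw: "v \<in> S" "w \<in> S" "v \<noteq> w"
      then obtain x where "v x \<noteq> w x" by (meson ext)
      moreover from this vw have "x \<in> X" by (metis (no_types, lifting) PiE_arb S_def mem_Collect_eq)
      ultimately show "cyl v \<inter> cyl w = {}"
        by (auto simp: cyl_def)
    qed
  qed
  ultimately show ?thesis
    by (simp add: cyl_def coin_prob_cylinder[OF X] S_def power_one_over field_simps)
qed

subsection \<open>Counting nonsingular matrices\<close>

definition indep_rows :: "nat \<Rightarrow> nat \<Rightarrow> (nat \<Rightarrow> nat \<Rightarrow> bit) \<Rightarrow> bool" where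
  "indep_rows m k D \<longleftrightarrow>
     (\<forall>y. (\<forall>c\<in>{1..m}. (\<Sum>i\<in>{1..k}. y i * D i c) = 0) \<longrightarrow> (\<forall>i\<in>{1..k}. y i = 0))"

definition indep_row_mats :: "nat \<Rightarrow> nat \<Rightarrow> (nat \<Rightarrow> nat \<Rightarrow> bit) set" where
  "indep_row_mats m k = {D \<in> PiE {1..k} (\<lambda>_. cube {1..m}). indep_rows m k D}"

lemma finite_indep_row_mats [simp]: "finite (indep_row_mats m k)"
proof -
  have "finite (PiE {1..k} (\<lambda>_. cube {1..m}))" by (intro finite_PiE) auto
  then show ?thesis by (simp add: indep_row_mats_def)
qed

definition row_span :: "nat \<Rightarrow> nat \<Rightarrow> (nat \<Rightarrow> nat \<Rightarrow> bit) \<Rightarrow> (nat \<Rightarrow> bit) set" where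
  "row_span m k D = (\<lambda>y. \<lambda>c\<in>{1..m}. \<Sum>i\<in>{1..k}. y i * D i c) ` cube {1..k}"

lemma card_row_span_le: "card (row_span m k D) \<le> 2 ^ k"
  unfolding row_span_def by (rule order_trans[OF card_image_le]) auto

text \<open>In a vanishing combination the coefficient of \<open>v\<close> must be 0: if it were 1,
  \<open>v\<close> would be a combination of the earlier rows.\<close>

lemma indep_rows_extend:
  assumes D: "indep_rows m k D" and v: "v \<in> cube {1..m} - row_span m k D"
  shows "indep_rows m (Suc k) (D(Suc k := v))"
  unfolding indep_rows_def
proof (intro allI impI)
  fix y assume y: "\<forall>c\<in>{1..m}. (\<Sum>i\<in>{1..Suc k}. y i * (D(Suc k := v)) i c) = 0"
  have split: "(\<Sum>i\<in>{1..Suc k}. y i * (D(Suc k := v)) i c) =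
      (\<Sum>i\<in>{1..k}. y i * D i c) + y (Suc k) * v c" for c
  proof -
    have "(\<Sum>i\<in>{1..k}. y i * (D(Suc k := v)) i c) = (\<Sum>i\<in>{1..k}. y i * D i c)"
      by (intro sum.cong) auto
    then show ?thesis by simp
  qed
  have "y (Suc k) = 0"
  proof (rule ccontr)
    assume "y (Suc k) \<noteq> 0"
    then have "y (Suc k) = 1" by simp
    with y have "\<forall>c\<in>{1..m}. v c = (\<Sum>i\<in>{1..k}. y i * D i c)"
      unfolding split by (simp add: add_bit_eq_0_iff)
    then have "v = (\<lambda>c\<in>{1..m}. \<Sum>i\<in>{1..k}. restrict y {1..k} i * D i c)"
      using v by (auto simp: fun_eq_iff PiE_def extensional_def)
    then have "v \<in> row_span m k D"
      unfolding row_span_def by (intro image_eqI[where x="restrict y {1..k}"]) auto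
    with v show False by simp
  qed
  moreover from this y D have "\<forall>i\<in>{1..k}. y i = 0"
    unfolding split indep_rows_def by auto
  ultimately show "\<forall>i\<in>{1..Suc k}. y i = 0" by (auto simp: le_Suc_eq)
qed

text \<open>A span of \<open>k\<close> rows has at most \<open>2 ^ k\<close> elements, so each
  independent matrix has at least \<open>2 ^ m - 2 ^ k\<close> independent extensions by a row.
  Distinct pairs \<open>(D, v)\<close> give distinct extensions.\<close>

lemma card_indep_row_mats_Suc:
  "real (card (indep_row_mats m k)) * (2 ^ m - 2 ^ k) \<le> real (card (indep_row_mats m (Suc k)))"
proof -
  let ?S = "SIGMA D:indep_row_mats m k. cube {1..m} - row_span m k D"
  have fin: "finite (cube {1..m})" by simp
  have "real (card (indep_row_mats m k)) * (2 ^ m - 2 ^ k) =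
      (\<Sum>D\<in>indep_row_mats m k. 2 ^ m - 2 ^ k)" by simp
  also have "\<dots> \<le> (\<Sum>D\<in>indep_row_mats m k. real (card (cube {1..m} - row_span m k D)))"
  proof (rule sum_mono)
    fix D
    have "row_span m k D \<subseteq> cube {1..m}" by (auto simp: row_span_def)
    then have "card (cube {1..m} - row_span m k D) = 2 ^ m - card (row_span m k D)"
      using finite_subset[OF _ fin] by (subst card_Diff_subset) auto
    moreover have "real (card (row_span m k D)) \<le> 2 ^ k"
      using card_row_span_le[of m k D] by (metis of_nat_le_iff of_nat_power of_nat_numeral)
    moreover have "card (row_span m k D) \<le> 2 ^ m"
      using card_mono[OF fin \<open>row_span m k D \<subseteq> cube {1..m}\<close>] by simp
    ultimately show "(2::real) ^ m - 2 ^ k \<le> real (card (cube {1..m} - row_span m k D))"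
      by (simp add: of_nat_diff)
  qed
  also have "\<dots> = real (card ?S)"
    by (subst card_SigmaI) (auto intro: finite_subset[OF _ fin])
  also have "card ?S \<le> card (indep_row_mats m (Suc k))"
  proof (rule card_inj_on_le[where f="\<lambda>(D, v). D(Suc k := v)"])
    show "inj_on (\<lambda>(D, v). D(Suc k := v)) ?S"
    proof (rule inj_onI, clarify)
      fix D v D' v'
      assume D: "D \<in> indep_row_mats m k" "D' \<in> indep_row_mats m k"
        and eq: "D(Suc k := v) = D'(Suc k := v')"
      have "D i = D' i" for i
      proof (cases "i = Suc k")
        case True
        then show ?thesis using D by (auto simp: indep_row_mats_def PiE_def extensional_def)
      next
        case False
        then show ?thesis using fun_cong[OF eq, of i] by simp
      qed
      moreover have "v = v'" using fun_cong[OF eq, of "Suc k"] by simp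
      ultimately show "D = D' \<and> v = v'" by auto
    qed
    show "(\<lambda>(D, v). D(Suc k := v)) ` ?S \<subseteq> indep_row_mats m (Suc k)"
    proof clarify
      fix D v
      assume D: "D \<in> indep_row_mats m k" and v: "v \<in> cube {1..m}" "v \<notin> row_span m k D"
      have "D(Suc k := v) \<in> PiE {1..Suc k} (\<lambda>_. cube {1..m})"
        using D v(1) unfolding indep_row_mats_def
        by (auto simp: PiE_def extensional_def Pi_def le_Suc_eq)
      then show "D(Suc k := v) \<in> indep_row_mats m (Suc k)"
        using D v indep_rows_extend[of m k D v] unfolding indep_row_mats_def by auto
    qed
  qed auto
  finally show ?thesis by simp
qed

text \<open>The plain bound \<open>1/4\<close> is not inductive. The extra term \<open>x\<close>
  repairs this, because \<open>(1/4 + x) * (1 - x)\<close> is at least \<open>1/4 + x/2\<close> for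
  \<open>x\<close> between 0 and \<open>1/4\<close>.\<close>

lemma prod_one_minus_half_powers:
  assumes "1 \<le> m"
  shows "1/4 + (1/2) ^ Suc m \<le> (\<Prod>i<m. 1 - (1/2 :: real) ^ Suc i)"
  using assms
proof (induction m rule: dec_induct)
  case base
  show ?case by (simp add: power2_eq_square)
next
  case (step m)
  define x where "x = (1/2 :: real) ^ Suc m"
  have x: "0 \<le> x" "x \<le> 1/4"
    using power_decreasing[of 2 "Suc m" "1/2::real"] step(1)
    by (auto simp: x_def power2_eq_square simp del: power_Suc)
  then have "1/4 + x/2 \<le> (1/4 + x) * (1 - x)"
    using mult_left_mono[OF x(2) x(1)] by (simp add: field_simps)
  also have "\<dots> \<le> (\<Prod>i<m. 1 - (1/2) ^ Suc i) * (1 - x)"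
    using step.IH x by (intro mult_right_mono) (auto simp: x_def)
  finally show ?case by (simp add: x_def)
qed

text \<open>Adding the rows one by one gives at least the product of the
  \<open>2 ^ m - 2 ^ i\<close>. Taking out \<open>2 ^ m\<close> from each factor and reversing the
  order leaves the product bounded above by no less than a quarter.\<close>

lemma card_indep_row_mats_ge:
  assumes "1 \<le> m"
  shows "2 ^ (m * m) \<le> 4 * real (card (indep_row_mats m m))"
proof -
  have ge: "(\<Prod>i<k. 2 ^ m - 2 ^ i) \<le> real (card (indep_row_mats m k))" if "k \<le> m" for k
    using that
  proof (induction k)
    case 0
    have "indep_row_mats m 0 = {\<lambda>_. undefined}"
      by (auto simp: indep_row_mats_def indep_rows_def)
    then show ?case by simp
  next
    case (Suc k)
    then have "(2::real) ^ k \<le> 2 ^ m" by (intro power_increasing) auto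
    then have "(\<Prod>i<Suc k. (2::real) ^ m - 2 ^ i) \<le> real (card (indep_row_mats m k)) * (2 ^ m - 2 ^ k)"
      using Suc by (auto intro!: mult_right_mono)
    also have "\<dots> \<le> real (card (indep_row_mats m (Suc k)))" by (rule card_indep_row_mats_Suc)
    finally show ?case .
  qed
  have "(\<Prod>i<m. (2::real) ^ m - 2 ^ i) = (\<Prod>i<m. 2 ^ m * (1 - (1/2) ^ Suc (m - Suc i)))"
  proof (rule prod.cong, simp)
    fix i assume "i \<in> {..<m}"
    then have "Suc (m - Suc i) = m - i" "(2::real) ^ m = 2 ^ (m - i) * 2 ^ i"
      by (auto simp flip: power_add)
    then show "(2::real) ^ m - 2 ^ i = 2 ^ m * (1 - (1/2) ^ Suc (m - Suc i))"
      by (simp add: algebra_simps power_divide del: power_Suc)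
  qed
  also have "\<dots> = 2 ^ (m * m) * (\<Prod>i<m. 1 - (1/2) ^ Suc (m - Suc i))"
    by (simp add: prod.distrib power_mult del: power_Suc)
  also have "(\<Prod>i<m. 1 - (1/2 :: real) ^ Suc (m - Suc i)) = (\<Prod>i<m. 1 - (1/2) ^ Suc i)"
    by (rule prod.nat_diff_reindex)
  also have "2 ^ (m * m) * (1/4) \<le> 2 ^ (m * m) * (\<Prod>i<m. 1 - (1/2 :: real) ^ Suc i)"
  proof (rule mult_left_mono)
    have "1/4 \<le> 1/4 + (1/2 :: real) ^ Suc m" by simp
    also note prod_one_minus_half_powers[OF assms]
    finally show "1/4 \<le> (\<Prod>i<m. 1 - (1/2 :: real) ^ Suc i)" .
  qed simp
  finally have "2 ^ (m * m) * (1/4) \<le> (\<Prod>i<m. (2::real) ^ m - 2 ^ i)" .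
  with ge[of m] show ?thesis by simp
qed

section \<open>Translation of bit matrices into zero-padded 0/1 matrices of naturals\<close>

definition nat_mat :: "nat \<Rightarrow> (nat \<Rightarrow> nat \<Rightarrow> bit) \<Rightarrow> nat \<Rightarrow> nat \<Rightarrow> nat" where
  "nat_mat m D i c = (if i \<in> {1..m} \<and> c \<in> {1..m} then of_bool (D i c = 1) else 0)"

lemma f2_mat_nat_mat: "f2_mat m (nat_mat m D)"
  by (auto simp: f2_mat_def nat_mat_def)

lemma of_nat_nat_mat:
  "i \<in> {1..m} \<Longrightarrow> c \<in> {1..m} \<Longrightarrow> (of_nat (nat_mat m D i c) :: bit) = D i c"
  by (auto simp: nat_mat_def)

lemma mod2_eq_iff_of_nat_bit:
  "n mod 2 = (if P then 1 else 0) \<longleftrightarrow> (of_nat n :: bit) = (if P then 1 else 0)"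
  using of_nat_bit_eq_0_iff[of n] by (auto simp: even_iff_mod_2_eq_zero odd_iff_mod_2_eq_one)

text \<open>Independent rows make \<open>y\<close> to \<open>y D\<close> injective on a finite cube,
  hence surjective. Preimages of the unit vectors are the rows of a left inverse \<open>E\<close>,
  and independence shows that it is a right inverse as well.\<close>

lemma f2_nonsingular_nat_mat:
  assumes D: "indep_rows m m D"
  shows "f2_nonsingular m (nat_mat m D)"
proof -
  define T where "T y = (\<lambda>c\<in>{1..m}. \<Sum>i\<in>{1..m}. y i * D i c)" for y
  have "inj_on T (cube {1..m})"
  proof (rule inj_onI)
    fix y y' assume y: "y \<in> cube {1..m}" "y' \<in> cube {1..m}" "T y = T y'"
    have "(\<Sum>i\<in>{1..m}. (y i + y' i) * D i c) = 0" if "c \<in> {1..m}" for c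
      using fun_cong[OF y(3), of c] that
      by (simp add: T_def distrib_right sum.distrib)
    then have "\<forall>i\<in>{1..m}. y i + y' i = 0"
      using D[unfolded indep_rows_def, THEN spec, of "\<lambda>i. y i + y' i"] by simp
    then show "y = y'" by (intro PiE_ext[OF y(1,2)]) (auto simp: add_bit_eq_0_iff)
  qed
  then have surj: "T ` cube {1..m} = cube {1..m}"
    by (intro endo_inj_surj) (auto simp: T_def)
  have "\<exists>y. T y = (\<lambda>c\<in>{1..m}. if i = c then 1 else 0)" for i
  proof -
    have "(\<lambda>c\<in>{1..m}. if i = c then 1 else 0 :: bit) \<in> T ` cube {1..m}" unfolding surj by auto
    then show ?thesis by auto
  qed
  then obtain E where E: "\<And>i. T (E i) = (\<lambda>c\<in>{1..m}. if i = c then 1 else 0)" by metis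
  have ED: "(\<Sum>l\<in>{1..m}. E i l * D l c) = (if i = c then 1 else 0)" if "c \<in> {1..m}" for i c
    using fun_cong[OF E[of i], of c] that by (simp add: T_def)
  have DE: "(\<Sum>l\<in>{1..m}. D i l * E l c) = (if i = c then 1 else 0)"
    if i: "i \<in> {1..m}" and c: "c \<in> {1..m}" for i c
  proof -
    \<comment> \<open>This is row \<open>i\<close> of \<open>D E - 1\<close>. Multiplied by
      \<open>D\<close> it gives \<open>D (E D) - D = 0\<close>, so it vanishes by independence of
      the rows.\<close>
    define y where "y l = (\<Sum>p\<in>{1..m}. D i p * E p l) + (if i = l then 1 else 0)" for l
    have "(\<Sum>l\<in>{1..m}. y l * D l c') = 0" if c': "c' \<in> {1..m}" for c'
    proof -
      have "(\<Sum>l\<in>{1..m}. (\<Sum>p\<in>{1..m}. D i p * E p l) * D l c') =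
          (\<Sum>l\<in>{1..m}. \<Sum>p\<in>{1..m}. D i p * (E p l * D l c'))"
        by (simp add: sum_distrib_right mult.assoc)
      also have "\<dots> = (\<Sum>p\<in>{1..m}. D i p * (\<Sum>l\<in>{1..m}. E p l * D l c'))"
        by (subst sum.swap) (simp add: sum_distrib_left)
      also have "\<dots> = (\<Sum>p\<in>{1..m}. if p = c' then D i p else 0)"
        by (intro sum.cong refl) (simp only: ED[OF c'] mult_1_right mult_zero_right split: if_split, simp)
      also have "\<dots> = D i c'" using c' by simp
      finally have "(\<Sum>l\<in>{1..m}. (\<Sum>p\<in>{1..m}. D i p * E p l) * D l c') = D i c'" .
      moreover have "(\<Sum>l\<in>{1..m}. (if i = l then 1 else 0) * D l c') = D i c'"
        using i by (simp add: if_distrib[of "\<lambda>x. x * _"] cong: if_cong)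
      ultimately show ?thesis by (simp add: y_def distrib_right sum.distrib)
    qed
    then have "y c = 0" using D[unfolded indep_rows_def, THEN spec, of y] c by simp
    then show ?thesis unfolding y_def by (simp only: add_bit_eq_0_iff)
  qed
  have conv: "(\<Sum>l\<in>{1..m}. nat_mat m F i l * nat_mat m H l c) mod 2 = (if i = c then 1 else 0)"
    if "(\<Sum>l\<in>{1..m}. F i l * H l c) = (if i = c then 1 else 0)" "i \<in> {1..m}" "c \<in> {1..m}"
    for F H i c
    using that by (simp add: mod2_eq_iff_of_nat_bit of_nat_nat_mat)
  show ?thesis
    unfolding f2_nonsingular_def using f2_mat_nat_mat ED DE conv
    by (intro conjI exI[of _ "nat_mat m E"]) blast+
qed

lemma inj_on_nat_mat: "inj_on (nat_mat m) (PiE {1..m} (\<lambda>_. cube {1..m}))"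
proof (rule inj_onI)
  fix D D'
  assume D: "D \<in> PiE {1..m} (\<lambda>_. cube {1..m})" "D' \<in> PiE {1..m} (\<lambda>_. cube {1..m})"
    and eq: "nat_mat m D = nat_mat m D'"
  have "D i c = D' i c" if "i \<in> {1..m}" "c \<in> {1..m}" for i c
    using of_nat_nat_mat[OF that, of D] of_nat_nat_mat[OF that, of D'] eq by simp
  moreover have "D i \<in> cube {1..m}" "D' i \<in> cube {1..m}" if "i \<in> {1..m}" for i
    using D that by auto
  ultimately have "D i = D' i" if "i \<in> {1..m}" for i
    using that by (metis PiE_ext)
  then show "D = D'" by (rule PiE_ext[OF D])
qed

lemma finite_f2_nonsingular: "finite {D. f2_nonsingular m D}"
proof -
  have "inj_on (\<lambda>D. \<lambda>x\<in>{1..m} \<times> {1..m}. of_nat (D (fst x) (snd x)) :: bit) {D. f2_mat m D}"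
  proof (rule inj_onI, clarify, intro ext)
    fix D D' i c
    assume D: "f2_mat m D" "f2_mat m D'" and
      eq: "(\<lambda>x\<in>{1..m} \<times> {1..m}. of_nat (D (fst x) (snd x)) :: bit) = (\<lambda>x\<in>{1..m} \<times> {1..m}. of_nat (D' (fst x) (snd x)))"
    show "D i c = D' i c"
    proof (cases "i \<in> {1..m} \<and> c \<in> {1..m}")
      case True
      then have "(of_nat (D i c) :: bit) = of_nat (D' i c)" using fun_cong[OF eq, of "(i, c)"] by simp
      moreover have "D i c \<in> {0, 1}" "D' i c \<in> {0, 1}" using D unfolding f2_mat_def by blast+
      ultimately show ?thesis by auto
    next
      case False
      then show ?thesis using D unfolding f2_mat_def by metis
    qed
  qed
  then have "finite {D. f2_mat m D}"
    by (rule inj_on_finite[where B="cube ({1..m} \<times> {1..m})"]) (auto split: if_splits)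
  then show ?thesis by (rule rev_finite_subset) (auto simp: f2_nonsingular_def)
qed

lemma card_f2_nonsingular_ge:
  assumes "1 \<le> m"
  shows "2 ^ (m * m) \<le> 4 * real (card {D. f2_nonsingular m D})"
proof -
  have "card (indep_row_mats m m) \<le> card {D. f2_nonsingular m D}"
  proof (rule card_inj_on_le[OF _ _ finite_f2_nonsingular])
    show "inj_on (nat_mat m) (indep_row_mats m m)"
      by (rule inj_on_subset[OF inj_on_nat_mat]) (auto simp: indep_row_mats_def)
    show "nat_mat m ` indep_row_mats m m \<subseteq> {D. f2_nonsingular m D}"
      by (auto simp: indep_row_mats_def f2_nonsingular_nat_mat)
  qed
  with card_indep_row_mats_ge[OF assms] show ?thesis by simp
qed

section \<open>Tuples of nonsingular matrices\<close>

lemma gen_tuples_bij: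
  "bij_betw (\<lambda>Cg. restrict Cg {1..s}) (gen_tuples s m) (PiE {1..s} (\<lambda>_. {D. f2_nonsingular m D}))"
proof (rule bij_betw_byWitness[where f'="\<lambda>F j. if j \<in> {1..s} then F j else (\<lambda>_ _. 0)"])
  show "\<forall>Cg\<in>gen_tuples s m. (\<lambda>j. if j \<in> {1..s} then restrict Cg {1..s} j else (\<lambda>_ _. 0)) = Cg"
    unfolding gen_tuples_def by (auto simp: fun_eq_iff)
qed (auto simp: gen_tuples_def fun_eq_iff PiE_def extensional_def)

text \<open>The nonsingular tuples have density at least \<open>4 ^ (- s)\<close> among all tuples
  of bit matrices. This is the source of the factor \<open>4 ^ s\<close> in the tail bound.\<close>

lemma card_gen_tuples_ge:
  assumes "1 \<le> m"
  shows "2 ^ (s * m * m) \<le> 4 ^ s * real (card (gen_tuples s m))"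
proof -
  have "(2 ^ (m * m)) ^ s \<le> (4 * real (card {D. f2_nonsingular m D})) ^ s"
    by (intro power_mono card_f2_nonsingular_ge[OF assms]) auto
  moreover have "card (gen_tuples s m) = card {D. f2_nonsingular m D} ^ s"
    using bij_betw_same_card[OF gen_tuples_bij] by (simp add: card_PiE)
  moreover have "(2::real) ^ (s * m * m) = (2 ^ (m * m)) ^ s"
    by (simp only: power_mult[symmetric] mult.assoc mult.commute[of s])
  ultimately show ?thesis
    by (simp add: power_mult_distrib)
qed

lemma finite_gen_tuples: "finite (gen_tuples s m)"
  using bij_betw_finite[OF gen_tuples_bij] finite_f2_nonsingular by (simp add: finite_PiE)

lemma gen_tuples_nonempty:
  assumes "1 \<le> m"
  shows "gen_tuples s m \<noteq> {}"
proof
  assume "gen_tuples s m = {}"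
  with card_gen_tuples_ge[OF assms, of s] show False by (simp add: not_le zero_less_power power_le_zero_eq)
qed

subsection \<open>The probability of a family of events as a character sum\<close>

text \<open>The coefficient of the scrambling entry \<open>M_j(l, l')\<close> when the equations,
  one for each index \<open>i\<close> and column \<open>c\<close>, are added with weights
  \<open>y (i, c)\<close>.\<close>

definition row_form :: "nat \<Rightarrow> (nat \<Rightarrow> nat \<Rightarrow> nat \<Rightarrow> bit) \<Rightarrow> nat set \<Rightarrow> (nat \<Rightarrow> nat \<Rightarrow> nat \<Rightarrow> bit)
    \<Rightarrow> (nat \<times> nat \<Rightarrow> bit) \<Rightarrow> nat \<Rightarrow> nat \<Rightarrow> nat \<Rightarrow> bit" where
  "row_form m C I a y j l l' = (\<Sum>c\<in>{1..m}. C j l' c * (\<Sum>i\<in>I. a i j l * y (i, c)))"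

text \<open>The probability that all the events indexed by \<open>I\<close> occur, multiplied by \<open>2 ^ (m * card I)\<close>
  and expanded into characters. The variable \<open>a i j l\<close> is digit \<open>l\<close> of the \<open>j\<close>-th component of
  the \<open>i\<close>-th index, and all digits are among the first \<open>n\<close>. A character \<open>y\<close> survives the average
  over the free entries \<open>l' < l\<close> of the scrambling matrices only if it is trivial on all of them;
  what remains is its sign on the unit diagonal.\<close>
definition rel_prob :: "nat \<Rightarrow> nat \<Rightarrow> nat \<Rightarrow> (nat \<Rightarrow> nat \<Rightarrow> nat \<Rightarrow> bit) \<Rightarrow> nat set
    \<Rightarrow> (nat \<Rightarrow> nat \<Rightarrow> nat \<Rightarrow> bit) \<Rightarrow> real" where
  "rel_prob s m n C I a = (\<Sum>y\<in>cube (I \<times> {1..m}).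
     if \<forall>j\<in>{1..s}. \<forall>l\<in>{1..n}. \<forall>l'\<in>{1..m} \<inter> {..<l}. row_form m C I a y j l l' = 0
     then chi (\<Sum>j\<in>{1..s}. \<Sum>l\<in>{1..n} \<inter> {..m}. row_form m C I a y j l l) else 0)"

text \<open>The random bits that matter when all digits are at most \<open>n\<close>: the entries
  strictly below the diagonal. A row \<open>l > m\<close> has no diagonal entry and all its
  \<open>m\<close> entries are free.\<close>

definition coins :: "nat \<Rightarrow> nat \<Rightarrow> nat \<Rightarrow> (nat \<times> nat \<times> nat) set" where
  "coins s m n = (SIGMA j:{1..s}. SIGMA l:{1..n}. {1..m} \<inter> {..<l})"

lemma finite_coins [simp]: "finite (coins s m n)"
  by (auto simp: coins_def)

definition scramble_entry :: "(nat \<times> nat \<times> nat \<Rightarrow> bit) \<Rightarrow> nat \<Rightarrow> nat \<Rightarrow> nat \<Rightarrow> bit" where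
  "scramble_entry v j l l' = (if l = l' then 1 else if l < l' then 0 else v (j, l, l'))"

definition annihilates :: "nat \<Rightarrow> nat \<Rightarrow> nat \<Rightarrow> (nat \<Rightarrow> nat \<Rightarrow> nat \<Rightarrow> bit) \<Rightarrow> nat set
    \<Rightarrow> (nat \<Rightarrow> nat \<Rightarrow> nat \<Rightarrow> bit) \<Rightarrow> (nat \<times> nat \<times> nat \<Rightarrow> bit) \<Rightarrow> bool" where
  "annihilates s m n C I a v \<longleftrightarrow> (\<forall>e\<in>I \<times> {1..m}. (\<Sum>j\<in>{1..s}. \<Sum>l\<in>{1..n}.
     a (fst e) j l * (\<Sum>l'\<in>{1..m}. scramble_entry v j l l' * C j l' (snd e))) = 0)"

lemma scramble_row:
  "(\<Sum>l'\<in>{1..m}. scramble_entry v j l l' * D l') =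
     (\<Sum>l'\<in>{1..m} \<inter> {..<l}. v (j, l, l') * D l') + (if l \<in> {1..m} then D l else 0)"
proof -
  have "(\<Sum>l'\<in>{1..m}. scramble_entry v j l l' * D l') =
      (\<Sum>l'\<in>{1..m}. (if l' < l then v (j, l, l') * D l' else 0) + (if l' = l then D l else 0))"
    by (intro sum.cong) (auto simp: scramble_entry_def)
  also have "\<dots> = (\<Sum>l'\<in>{1..m}. if l' < l then v (j, l, l') * D l' else 0) + (if l \<in> {1..m} then D l else 0)"
    by (simp add: sum.distrib)
  also have "(\<Sum>l'\<in>{1..m}. if l' < l then v (j, l, l') * D l' else 0) =
      (\<Sum>l'\<in>{1..m} \<inter> {..<l}. v (j, l, l') * D l')"
    by (subst sum.inter_restrict) auto
  finally show ?thesis .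
qed

lemma sum_digits_le:
  fixes n :: nat
  shows "(\<Sum>l\<in>{1..n}. if l \<in> {1..m} then f l else 0) = (\<Sum>l\<in>{1..n} \<inter> {..m}. f l :: bit)"
proof -
  have "(\<Sum>l\<in>{1..n} \<inter> {..m}. f l) = (\<Sum>l\<in>{1..n}. if l \<in> {..m} then f l else 0)"
    by (subst sum.inter_restrict) auto
  then show ?thesis by (auto intro!: sum.cong)
qed

text \<open>Splitting each scrambled row into free entries and unit diagonal turns the events into
  an affine system in the coins. The diagonal, present only in rows up to \<open>m\<close>, supplies
  the right-hand side.\<close>

lemma annihilates_iff_linear:
  "annihilates s m n C I a v \<longleftrightarrow> (\<forall>e\<in>I \<times> {1..m}.
     (\<Sum>x\<in>coins s m n. (case x of (j, l, l') \<Rightarrow> a (fst e) j l * C j l' (snd e)) * v x) =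
     (\<Sum>j\<in>{1..s}. \<Sum>l\<in>{1..n} \<inter> {..m}. a (fst e) j l * C j l (snd e)))"
proof -
  have "(\<Sum>j\<in>{1..s}. \<Sum>l\<in>{1..n}. a i j l * (\<Sum>l'\<in>{1..m}. scramble_entry v j l l' * C j l' c)) =
     (\<Sum>x\<in>coins s m n. (case x of (j, l, l') \<Rightarrow> a i j l * C j l' c) * v x) +
     (\<Sum>j\<in>{1..s}. \<Sum>l\<in>{1..n} \<inter> {..m}. a i j l * C j l c)" for i c
  proof -
    have "(\<Sum>x\<in>coins s m n. (case x of (j, l, l') \<Rightarrow> a i j l * C j l' c) * v x) =
        (\<Sum>j\<in>{1..s}. \<Sum>l\<in>{1..n}. \<Sum>l'\<in>{1..m} \<inter> {..<l}. a i j l * C j l' c * v (j, l, l'))"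
      unfolding coins_def by (simp add: sum.Sigma split_def)
    moreover have "(\<Sum>j\<in>{1..s}. \<Sum>l\<in>{1..n} \<inter> {..m}. a i j l * C j l c) =
       (\<Sum>j\<in>{1..s}. \<Sum>l\<in>{1..n}. a i j l * (if l \<in> {1..m} then C j l c else 0))"
      unfolding sum_digits_le[symmetric] by (intro sum.cong) auto
    ultimately show ?thesis
      by (simp only: scramble_row distrib_left sum.distrib sum_distrib_left mult.assoc mult.commute[of "v _"])
  qed
  then show ?thesis by (simp add: annihilates_def add_bit_eq_0_iff)
qed

lemma card_annihilates:
  assumes I: "finite I"
  shows "2 ^ (m * card I) * real (card {v \<in> cube (coins s m n). annihilates s m n C I a v}) =
    2 ^ card (coins s m n) * rel_prob s m n C I a"
proof -
  have form: "(\<Sum>e\<in>I \<times> {1..m}. y e * (a (fst e) j l * C j l' (snd e))) = row_form m C I a y j l l'"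
    for y j l l'
  proof -
    have "row_form m C I a y j l l' = (\<Sum>c\<in>{1..m}. \<Sum>i\<in>I. y (i, c) * (a i j l * C j l' c))"
      by (simp add: row_form_def sum_distrib_left mult_ac)
    then show ?thesis by (subst (asm) sum.swap) (simp add: sum.cartesian_product split_def)
  qed
  have sgn: "(\<Sum>e\<in>I \<times> {1..m}. y e * (\<Sum>j\<in>{1..s}. \<Sum>l\<in>{1..n} \<inter> {..m}. a (fst e) j l * C j l (snd e))) =
      (\<Sum>j\<in>{1..s}. \<Sum>l\<in>{1..n} \<inter> {..m}. row_form m C I a y j l l)" for y
    unfolding form[symmetric] sum_distrib_left
    by (subst sum.swap, subst (2) sum.swap) (rule refl)
  have ker: "(\<forall>x\<in>coins s m n. (\<Sum>e\<in>I \<times> {1..m}. y e * (case x of (j, l, l') \<Rightarrow> a (fst e) j l * C j l' (snd e))) = 0)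
      \<longleftrightarrow> (\<forall>j\<in>{1..s}. \<forall>l\<in>{1..n}. \<forall>l'\<in>{1..m} \<inter> {..<l}. row_form m C I a y j l l' = 0)" for y
    unfolding form[symmetric] coins_def by auto
  have "2 ^ card (I \<times> {1..m}) * real (card {v \<in> cube (coins s m n). annihilates s m n C I a v}) =
     2 ^ card (coins s m n) * rel_prob s m n C I a"
    unfolding annihilates_iff_linear
    by (subst card_linear_solutions) (use I in \<open>simp_all only: rel_prob_def sgn ker finite_coins finite_SigmaI finite_atLeastAtMost\<close>)
  then show ?thesis by (simp add: card_cartesian_product mult.commute)
qed

text \<open>The signs in the character sum hide this; it follows because \<open>rel_prob\<close> is
  a rescaled count.\<close>

lemma rel_prob_nonneg:
  assumes "finite I"
  shows "0 \<le> rel_prob s m n C I a"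
proof -
  have "0 \<le> 2 ^ card (coins s m n) * rel_prob s m n C I a"
    by (subst card_annihilates[OF assms, symmetric]) simp
  then show ?thesis by (simp add: zero_le_mult_iff power_le_zero_eq)
qed

definition digit_family :: "(nat \<Rightarrow> nat \<Rightarrow> nat) \<Rightarrow> nat \<Rightarrow> nat \<Rightarrow> nat \<Rightarrow> bit" where
  "digit_family k i j l = of_bool (l \<in> digits (k i j))"

text \<open>The bound on the digits makes the events depend only on the finitely many coins in
  \<open>coins s m n\<close>, so that the probability becomes a count of solutions.\<close>

lemma Pr_all_eq_rel_prob:
  assumes I: "finite I" and dig: "\<And>i j. i \<in> I \<Longrightarrow> j \<in> {1..s} \<Longrightarrow> digits (k i j) \<subseteq> {1..n}"
  shows "2 ^ (m * card I) * Pr_all s m Cg (k ` I) =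
    rel_prob s m n (\<lambda>j l c. of_nat (Cg j l c)) I (digit_family k)"
proof -
  let ?C = "\<lambda>j l c. of_nat (Cg j l c) :: bit"
  let ?v = "\<lambda>\<omega>. \<lambda>x\<in>coins s m n. of_bool (\<omega> x) :: bit"
  have Ment: "of_nat (Ment \<omega> j l l') = scramble_entry (?v \<omega>) j l l'"
    if "j \<in> {1..s}" "l \<in> {1..n}" "l' \<in> {1..m}" for \<omega> j l l'
    using that by (auto simp: Ment_def scramble_entry_def coins_def)
  have digit_sum: "(\<Sum>l\<in>digits (k i j). f l :: bit) = (\<Sum>l\<in>{1..n}. digit_family k i j l * f l)"
    if "i \<in> I" "j \<in> {1..s}" for i j f
  proof -
    have "(\<Sum>l\<in>{1..n}. digit_family k i j l * f l) = (\<Sum>l\<in>{1..n}. if l \<in> digits (k i j) then f l else 0)"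
      by (intro sum.cong) (auto simp: digit_family_def)
    also have "\<dots> = (\<Sum>l\<in>{1..n} \<inter> digits (k i j). f l)" by (subst sum.inter_restrict) auto
    also have "{1..n} \<inter> digits (k i j) = digits (k i j)" using dig[OF that] by blast
    finally show ?thesis by simp
  qed
  have Zev: "Zev s m Cg \<omega> (k i) \<longleftrightarrow> (\<forall>c\<in>{1..m}. (\<Sum>j\<in>{1..s}. \<Sum>l\<in>{1..n}. digit_family k i j l *
       (\<Sum>l'\<in>{1..m}. scramble_entry (?v \<omega>) j l l' * ?C j l' c)) = 0)" if i: "i \<in> I" for \<omega> i
  proof -
    have "of_nat (\<Sum>j\<in>{1..s}. \<Sum>l\<in>digits (k i j). \<Sum>l'\<in>{1..m}. Ment \<omega> j l l' * Cg j l' c) =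
      (\<Sum>j\<in>{1..s}. \<Sum>l\<in>{1..n}. digit_family k i j l *
       (\<Sum>l'\<in>{1..m}. scramble_entry (?v \<omega>) j l l' * ?C j l' c))" for c
      unfolding of_nat_sum of_nat_mult
    proof (rule sum.cong[OF refl])
      fix j assume j: "j \<in> {1..s}"
      show "(\<Sum>l\<in>digits (k i j). \<Sum>l'\<in>{1..m}. of_nat (Ment \<omega> j l l') * ?C j l' c) =
        (\<Sum>l\<in>{1..n}. digit_family k i j l * (\<Sum>l'\<in>{1..m}. scramble_entry (?v \<omega>) j l l' * ?C j l' c))"
        unfolding digit_sum[OF i j]
        by (intro sum.cong refl arg_cong2[where f="(*)"] Ment j)
    qed
    then show ?thesis unfolding Zev_def of_nat_bit_eq_0_iff[symmetric] by (simp only: )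
  qed
  have "Pr_all s m Cg (k ` I) =
      real (card {v \<in> cube (coins s m n). annihilates s m n ?C I (digit_family k) v}) / 2 ^ card (coins s m n)"
    unfolding Pr_all_def
  proof (rule coin_prob_eq)
    fix \<omega>
    show "(\<forall>k\<in>k ` I. Zev s m Cg \<omega> k) \<longleftrightarrow> annihilates s m n ?C I (digit_family k) (?v \<omega>)"
      unfolding annihilates_def ball_simps using Zev[of _ \<omega>] by (simp del: atLeastAtMost_iff)
  qed simp
  then show ?thesis
    using card_annihilates[OF I, of m s n ?C "digit_family k"] by simp
qed

subsection \<open>Averaging over all matrices\<close>

text \<open>Linear independence of the digit vectors, stated for arbitrary bit families so that it
  can be carried through the elimination of indices.\<close>

definition f2_free :: "nat \<Rightarrow> nat \<Rightarrow> nat set \<Rightarrow> (nat \<Rightarrow> nat \<Rightarrow> nat \<Rightarrow> bit) \<Rightarrow> bool" where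
  "f2_free s n I a \<longleftrightarrow> (\<forall>y. (\<forall>j\<in>{1..s}. \<forall>l\<in>{1..n}. (\<Sum>i\<in>I. a i j l * y i) = 0) \<longrightarrow> (\<forall>i\<in>I. y i = 0))"

text \<open>Back substitution from the last column: in column \<open>l\<close> only rows
  \<open>p >= l\<close> contribute, and those with \<open>p > l\<close> have already been shown to
  have coefficient 0.\<close>

lemma unit_triangular_kernel:
  assumes "\<forall>l'\<in>{1..m}. (\<Sum>l\<in>{1..m}. z l * scramble_entry v j l l') = 0" and "l \<in> {1..m}"
  shows "z l = 0"
  using assms(2)
proof (induction "m - l" arbitrary: l rule: less_induct)
  case less
  have "z p * scramble_entry v j p l = (if p = l then z l else 0)" if "p \<in> {1..m}" for p
    using less.hyps[of p] less.prems that by (cases p l rule: linorder_cases) (auto simp: scramble_entry_def)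
  then have "(\<Sum>p\<in>{1..m}. z p * scramble_entry v j p l) = (\<Sum>p\<in>{1..m}. if p = l then z l else 0)"
    by (rule sum.cong[OF refl])
  also have "\<dots> = z l" using less.prems by simp
  finally show ?case using assms(1) less.prems by simp
qed

lemma sum_triple: "(\<Sum>x\<in>A \<times> B \<times> D. f x) = (\<Sum>i\<in>A. \<Sum>j\<in>B. \<Sum>k\<in>D. f (i, j, k))"
  by (simp add: sum.cartesian_product split_def)

text \<open>Here the scrambling \<open>v\<close> is fixed and the matrix entries are the unknowns.
  The system is homogeneous of full rank: a relation between its equations, multiplied out column by
  column, is killed first by the unit triangular scrambling and then by independence of the digit
  vectors.\<close>

lemma card_matrices_annihilated:
  assumes I: "finite I" and free: "f2_free s m I a"
  shows "2 ^ (m * card I) * real (card {D \<in> cube ({1..s} \<times> {1..m} \<times> {1..m}).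
    annihilates s m m (\<lambda>j l c. D (j, l, c)) I a v}) = 2 ^ (s * m * m)"
proof -
  let ?X = "{1..s} \<times> {1..m} \<times> {1..m}"
  define b where "b i j l' = (\<Sum>l\<in>{1..m}. a i j l * scramble_entry v j l l')" for i j l'
  \<comment> \<open>An equation for column \<open>snd e\<close> involves only matrix entries of that
    column; their coefficients are the digit vector of the index times the scrambling
    matrix.\<close>
  define B where "B e x = (case x of (j, l', c) \<Rightarrow> if snd e = c then b (fst e) j l' else 0)"
    for e :: "nat \<times> nat" and x
  have lin: "annihilates s m m (\<lambda>j l c. D (j, l, c)) I a v \<longleftrightarrow>
      (\<forall>e\<in>I \<times> {1..m}. (\<Sum>x\<in>?X. B e x * D x) = 0)" for D
    unfolding annihilates_def
  proof (rule ball_cong[OF refl])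
    fix e assume e: "e \<in> I \<times> {1..m}"
    have "(\<Sum>x\<in>?X. B e x * D x) =
        (\<Sum>j\<in>{1..s}. \<Sum>l'\<in>{1..m}. \<Sum>c\<in>{1..m}. if snd e = c then b (fst e) j l' * D (j, l', c) else 0)"
      unfolding B_def sum_triple by (intro sum.cong refl) simp
    also have "\<dots> = (\<Sum>j\<in>{1..s}. \<Sum>l'\<in>{1..m}. b (fst e) j l' * D (j, l', snd e))"
      using e by (intro sum.cong refl) auto
    also have "\<dots> = (\<Sum>j\<in>{1..s}. \<Sum>l\<in>{1..m}. a (fst e) j l *
        (\<Sum>l'\<in>{1..m}. scramble_entry v j l l' * D (j, l', snd e)))"
      unfolding b_def sum_distrib_left sum_distrib_right
      by (rule sum.cong[OF refl], subst sum.swap) (simp add: mult.assoc)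
    finally show "((\<Sum>j\<in>{1..s}. \<Sum>l\<in>{1..m}. a (fst e) j l *
        (\<Sum>l'\<in>{1..m}. scramble_entry v j l l' * D (j, l', snd e))) = 0) \<longleftrightarrow> (\<Sum>x\<in>?X. B e x * D x) = 0"
      by (simp only: )
  qed
  have "2 ^ card (I \<times> {1..m}) *
      real (card {D \<in> cube ?X. \<forall>e\<in>I \<times> {1..m}. (\<Sum>x\<in>?X. B e x * D x) = 0}) = 2 ^ card ?X"
  proof (rule card_linear_solutions_full_rank)
    fix y e
    assume y: "\<forall>x\<in>?X. (\<Sum>e\<in>I \<times> {1..m}. y e * B e x) = 0" and e: "e \<in> I \<times> {1..m}"
    obtain i0 c where ic: "e = (i0, c)" "i0 \<in> I" "c \<in> {1..m}" using e by auto
    define z where "z j l = (\<Sum>i\<in>I. a i j l * y (i, c))" for j l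
    have "z j l = 0" if j: "j \<in> {1..s}" and l: "l \<in> {1..m}" for j l
    proof (rule unit_triangular_kernel[OF _ l])
      show "\<forall>l'\<in>{1..m}. (\<Sum>l\<in>{1..m}. z j l * scramble_entry v j l l') = 0"
      proof
        fix l' assume l': "l' \<in> {1..m}"
        have "0 = (\<Sum>e\<in>I \<times> {1..m}. y e * B e (j, l', c))" using y j l' ic by auto
        also have "\<dots> = (\<Sum>i\<in>I. \<Sum>c'\<in>{1..m}. if c' = c then y (i, c') * b i j l' else 0)"
          unfolding B_def sum.cartesian_product by (intro sum.cong refl) auto
        also have "\<dots> = (\<Sum>i\<in>I. y (i, c) * b i j l')"
          using ic by (intro sum.cong refl) auto
        also have "\<dots> = (\<Sum>l\<in>{1..m}. z j l * scramble_entry v j l l')"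
          unfolding b_def z_def sum_distrib_left sum_distrib_right
          by (subst sum.swap) (simp add: mult_ac)
        finally show "(\<Sum>l\<in>{1..m}. z j l * scramble_entry v j l l') = 0" by (simp only: )
      qed
    qed
    then show "y e = 0"
      using free[unfolded f2_free_def, THEN spec, of "\<lambda>i. y (i, c)"] ic by (simp add: z_def)
  qed (use I in auto)
  then show ?thesis
    by (simp add: lin card_cartesian_product mult.commute mult.left_commute)
qed

text \<open>Double counting of pairs of a matrix tuple and a coin vector: the count for fixed
  \<open>v\<close> does not depend on \<open>v\<close>. Equivalently, \<open>rel_prob\<close> has
  average 1 over all tuples of bit matrices.\<close>

lemma sum_rel_prob:
  assumes I: "finite I" and free: "f2_free s m I a"
  shows "(\<Sum>D\<in>cube ({1..s} \<times> {1..m} \<times> {1..m}). rel_prob s m m (\<lambda>j l c. D (j, l, c)) I a) = 2 ^ (s * m * m)"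
proof -
  let ?Y = "cube ({1..s} \<times> {1..m} \<times> {1..m})" and ?V = "cube (coins s m m)"
  let ?R = "\<lambda>D v. annihilates s m m (\<lambda>j l c. D (j, l, c)) I a v"
  have count: "real (card {x \<in> A. P x}) = (\<Sum>x\<in>A. of_bool (P x))" if "finite A" for A and P :: "'b \<Rightarrow> bool"
    using that by (simp add: Int_def)
  have "2 ^ card (coins s m m) * (\<Sum>D\<in>?Y. rel_prob s m m (\<lambda>j l c. D (j, l, c)) I a) =
      2 ^ (m * card I) * (\<Sum>D\<in>?Y. real (card {v \<in> ?V. ?R D v}))"
    by (simp only: sum_distrib_left card_annihilates[OF I])
  also have "(\<Sum>D\<in>?Y. real (card {v \<in> ?V. ?R D v})) = (\<Sum>D\<in>?Y. \<Sum>v\<in>?V. of_bool (?R D v))"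
    by (intro sum.cong refl count) auto
  also have "\<dots> = (\<Sum>v\<in>?V. \<Sum>D\<in>?Y. of_bool (?R D v))" by (rule sum.swap)
  also have "\<dots> = (\<Sum>v\<in>?V. real (card {D \<in> ?Y. ?R D v}))"
    by (intro sum.cong refl count[symmetric]) auto
  also have "2 ^ (m * card I) * \<dots> = (\<Sum>v\<in>?V. 2 ^ (s * m * m))"
    unfolding sum_distrib_left by (intro sum.cong refl card_matrices_annihilated[OF I free])
  also have "\<dots> = 2 ^ card (coins s m m) * 2 ^ (s * m * m)" by simp
  finally show ?thesis by simp
qed

subsection \<open>Only the last row of each digit pattern matters\<close>

text \<open>The value 0 means that no row among the first \<open>m\<close> has the digit pattern \<open>u\<close>.\<close>
definition top_row :: "nat \<Rightarrow> nat set \<Rightarrow> (nat \<Rightarrow> nat \<Rightarrow> nat \<Rightarrow> bit) \<Rightarrow> nat \<Rightarrow> nat set \<Rightarrow> nat" where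
  "top_row m I a j u = Max (insert 0 {l \<in> {1..m}. {i \<in> I. a i j l = 1} = u})"

lemma top_row_le: "top_row m I a j u \<le> m"
  unfolding top_row_def by (subst Max_le_iff) auto

lemma le_top_row: "l \<in> {1..m} \<Longrightarrow> {i \<in> I. a i j l = 1} = u \<Longrightarrow> l \<le> top_row m I a j u"
  unfolding top_row_def by (rule Max_ge) auto

lemma top_row_pattern:
  assumes "top_row m I a j u \<noteq> 0"
  shows "top_row m I a j u \<in> {1..m}" "{i \<in> I. a i j (top_row m I a j u) = 1} = u"
proof -
  have "top_row m I a j u \<in> insert 0 {l \<in> {1..m}. {i \<in> I. a i j l = 1} = u}"
    unfolding top_row_def by (rule Max_in) auto
  with assms show "top_row m I a j u \<in> {1..m}" "{i \<in> I. a i j (top_row m I a j u) = 1} = u" by auto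
qed

definition pattern_form :: "nat \<Rightarrow> (nat \<Rightarrow> nat \<Rightarrow> nat \<Rightarrow> bit) \<Rightarrow> (nat \<times> nat \<Rightarrow> bit)
    \<Rightarrow> nat \<Rightarrow> nat set \<Rightarrow> nat \<Rightarrow> bit" where
  "pattern_form m C y j u l' = (\<Sum>c\<in>{1..m}. C j l' c * (\<Sum>i\<in>u. y (i, c)))"

text \<open>Rows with the same pattern \<open>u\<close> impose nested conditions, so the last such
  row implies all the others. Under its condition the diagonal terms of the earlier rows vanish too,
  and only the one of the last row can affect the sign.\<close>

lemma rel_prob_eq_top_row:
  assumes I: "finite I"
  shows "rel_prob s m m C I a = (\<Sum>y\<in>cube (I \<times> {1..m}).
     if \<forall>j\<in>{1..s}. \<forall>u\<in>Pow I - {{}}. \<forall>l'\<in>{1..m} \<inter> {..<top_row m I a j u}. pattern_form m C y j u l' = 0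
     then chi (\<Sum>j\<in>{1..s}. \<Sum>u\<in>Pow I - {{}}.
       if top_row m I a j u = 0 then 0 else pattern_form m C y j u (top_row m I a j u)) else 0)"
  unfolding rel_prob_def
proof (rule sum.cong[OF refl])
  fix y
  define pat where "pat j l = {i \<in> I. a i j l = 1}" for j l
  let ?top = "top_row m I a"
  have form: "row_form m C I a y j l l' = pattern_form m C y j (pat j l) l'" for j l l'
  proof -
    have "(\<Sum>i\<in>I. a i j l * y (i, c)) = (\<Sum>i\<in>pat j l. y (i, c))" for c
    proof -
      have "(\<Sum>i\<in>I. a i j l * y (i, c)) = (\<Sum>i\<in>I. if a i j l = 1 then y (i, c) else 0)"
        by (intro sum.cong) auto
      also have "\<dots> = (\<Sum>i\<in>pat j l. y (i, c))"
        unfolding pat_def using I by (subst sum.inter_filter) auto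
      finally show ?thesis .
    qed
    then show ?thesis by (simp add: row_form_def pattern_form_def)
  qed
  have form_empty: "pattern_form m C y j {} l' = 0" for j l' by (simp add: pattern_form_def)
  have cond: "(\<forall>j\<in>{1..s}. \<forall>l\<in>{1..m}. \<forall>l'\<in>{1..m} \<inter> {..<l}. row_form m C I a y j l l' = 0) \<longleftrightarrow>
     (\<forall>j\<in>{1..s}. \<forall>u\<in>Pow I - {{}}. \<forall>l'\<in>{1..m} \<inter> {..<?top j u}. pattern_form m C y j u l' = 0)"
    (is "?L \<longleftrightarrow> ?R")
  proof
    assume L: ?L
    show ?R
    proof (intro ballI)
      fix j u l' assume j: "j \<in> {1..s}" and u: "u \<in> Pow I - {{}}" and l': "l' \<in> {1..m} \<inter> {..<?top j u}"
      then have "?top j u \<noteq> 0" by auto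
      from top_row_pattern[OF this] have "?top j u \<in> {1..m}" "pat j (?top j u) = u" by (auto simp: pat_def)
      with L j l' show "pattern_form m C y j u l' = 0" unfolding form by metis
    qed
  next
    assume R: ?R
    show ?L
    proof (intro ballI)
      fix j l l' assume j: "j \<in> {1..s}" and l: "l \<in> {1..m}" and l': "l' \<in> {1..m} \<inter> {..<l}"
      show "row_form m C I a y j l l' = 0"
      proof (cases "pat j l = {}")
        case True
        then show ?thesis by (simp add: form form_empty)
      next
        case False
        have "l \<le> ?top j (pat j l)" by (rule le_top_row[OF l]) (simp add: pat_def)
        with l' have "l' \<in> {1..m} \<inter> {..<?top j (pat j l)}" by auto
        moreover have "pat j l \<in> Pow I - {{}}" using False by (auto simp: pat_def)
        ultimately show ?thesis using R j unfolding form by blast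
      qed
    qed
  qed
  have sgn: "(\<Sum>l\<in>{1..m} \<inter> {..m}. row_form m C I a y j l l) =
      (\<Sum>u\<in>Pow I - {{}}. if ?top j u = 0 then 0 else pattern_form m C y j u (?top j u))"
    if R: "\<forall>u\<in>Pow I - {{}}. \<forall>l'\<in>{1..m} \<inter> {..<?top j u}. pattern_form m C y j u l' = 0" for j
  proof -
    have "{1..m} \<inter> {..m} = {1..m}" by auto
    then have "(\<Sum>l\<in>{1..m} \<inter> {..m}. row_form m C I a y j l l) = (\<Sum>l\<in>{1..m}. pattern_form m C y j (pat j l) l)"
      by (simp add: form)
    also have "\<dots> = (\<Sum>u\<in>Pow I. \<Sum>l\<in>{l \<in> {1..m}. pat j l = u}. pattern_form m C y j (pat j l) l)"
      by (rule sum.group[symmetric]) (use I in \<open>auto simp: pat_def\<close>)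
    also have "\<dots> = (\<Sum>u\<in>Pow I. \<Sum>l\<in>{l \<in> {1..m}. pat j l = u}. pattern_form m C y j u l)"
      by (intro sum.cong refl) auto
    also have "\<dots> = (\<Sum>u\<in>Pow I - {{}}. \<Sum>l\<in>{l \<in> {1..m}. pat j l = u}. pattern_form m C y j u l)"
      by (rule sum.mono_neutral_right) (use I in \<open>auto simp: form_empty\<close>)
    also have "\<dots> = (\<Sum>u\<in>Pow I - {{}}. if ?top j u = 0 then 0 else pattern_form m C y j u (?top j u))"
    proof (rule sum.cong[OF refl])
      fix u assume u: "u \<in> Pow I - {{}}"
      let ?S = "{l \<in> {1..m}. pat j l = u}"
      have le: "l \<le> ?top j u" if "l \<in> ?S" for l
        using that le_top_row[of l m I a j u] by (auto simp: pat_def)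
      show "(\<Sum>l\<in>?S. pattern_form m C y j u l) = (if ?top j u = 0 then 0 else pattern_form m C y j u (?top j u))"
      proof (cases "?top j u = 0")
        case True
        then have "?S = {}" using le by fastforce
        with True show ?thesis by (simp only: sum.empty simp_thms if_True)
      next
        case False
        have "(\<Sum>l\<in>?S. pattern_form m C y j u l) = (\<Sum>l\<in>{?top j u}. pattern_form m C y j u l)"
        proof (rule sum.mono_neutral_right)
          show "{?top j u} \<subseteq> ?S" using top_row_pattern[OF False] by (auto simp: pat_def)
          \<comment> \<open>An earlier row \<open>l\<close> lies strictly below the top row number,
            so its diagonal term is itself one of the forms required to vanish.\<close>
          show "\<forall>l\<in>?S - {?top j u}. pattern_form m C y j u l = 0"
          proof
            fix l assume l: "l \<in> ?S - {?top j u}"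
            with le[of l] have "l \<in> {1..m} \<inter> {..<?top j u}" by auto
            with R u show "pattern_form m C y j u l = 0" by blast
          qed
        qed simp
        with False show ?thesis by simp
      qed
    qed
    finally show ?thesis .
  qed
  show "(if \<forall>j\<in>{1..s}. \<forall>l\<in>{1..m}. \<forall>l'\<in>{1..m} \<inter> {..<l}. row_form m C I a y j l l' = 0
      then chi (\<Sum>j\<in>{1..s}. \<Sum>l\<in>{1..m} \<inter> {..m}. row_form m C I a y j l l) else 0) =
     (if \<forall>j\<in>{1..s}. \<forall>u\<in>Pow I - {{}}. \<forall>l'\<in>{1..m} \<inter> {..<?top j u}. pattern_form m C y j u l' = 0
      then chi (\<Sum>j\<in>{1..s}. \<Sum>u\<in>Pow I - {{}}. if ?top j u = 0 then 0 else pattern_form m C y j u (?top j u)) else 0)"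
    unfolding cond
  proof (rule if_cong[OF refl _ refl], rule arg_cong[where f=chi], rule sum.cong[OF refl])
    fix j
    assume "\<forall>j\<in>{1..s}. \<forall>u\<in>Pow I - {{}}. \<forall>l'\<in>{1..m} \<inter> {..<?top j u}. pattern_form m C y j u l' = 0" and j: "j \<in> {1..s}"
    then show "(\<Sum>l\<in>{1..m} \<inter> {..m}. row_form m C I a y j l l) =
      (\<Sum>u\<in>Pow I - {{}}. if ?top j u = 0 then 0 else pattern_form m C y j u (?top j u))"
      by (intro sgn) blast
  qed
qed

text \<open>Restricted to a finite domain, so that the possible values form a finite product that
  can be counted.\<close>

definition top_rows :: "nat \<Rightarrow> nat \<Rightarrow> nat set \<Rightarrow> (nat \<Rightarrow> nat \<Rightarrow> nat \<Rightarrow> bit) \<Rightarrow> nat \<times> nat set \<Rightarrow> nat" where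
  "top_rows s m I a = (\<lambda>(j, u)\<in>{1..s} \<times> (Pow I - {{}}). top_row m I a j u)"

lemma rel_prob_cong_top_rows:
  assumes I: "finite I" and eq: "top_rows s m I a = top_rows s m I a'"
  shows "rel_prob s m m C I a = rel_prob s m m C I a'"
proof -
  have "top_row m I a j u = top_row m I a' j u" if "j \<in> {1..s}" "u \<in> Pow I - {{}}" for j u
    using fun_cong[OF eq, of "(j, u)"] that by (auto simp: top_rows_def)
  then show ?thesis
    unfolding rel_prob_eq_top_row[OF I]
    by (intro sum.cong refl if_cong ball_cong arg_cong[where f=chi]) simp_all
qed

lemma top_rows_range: "top_rows s m I a \<in> PiE ({1..s} \<times> (Pow I - {{}})) (\<lambda>_. {..m})"
  unfolding top_rows_def by (auto simp: top_row_le split: if_splits)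

subsection \<open>Eliminating digits beyond the matrix size\<close>

text \<open>Substituting the relation for \<open>y i0\<close> adds the coefficient
  \<open>b i0\<close> to that of every other variable in \<open>u\<close>.\<close>

lemma sum_eliminate_index:
  fixes b y :: "nat \<Rightarrow> bit"
  assumes I: "finite I" and u: "u \<subseteq> I" "i0 \<in> u" and y: "y i0 = (\<Sum>i\<in>u - {i0}. y i)"
  shows "(\<Sum>i\<in>I. b i * y i) = (\<Sum>i\<in>I - {i0}. (if i \<in> u then b i + b i0 else b i) * y i)"
proof -
  have "(\<Sum>i\<in>I - {i0}. (if i \<in> u then b i + b i0 else b i) * y i) =
      (\<Sum>i\<in>I - {i0}. b i * y i + (if i \<in> u then b i0 * y i else 0))"
    by (intro sum.cong) (auto simp: distrib_right)
  also have "\<dots> = (\<Sum>i\<in>I - {i0}. b i * y i) + (\<Sum>i\<in>I - {i0}. if i \<in> u then b i0 * y i else 0)"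
    by (rule sum.distrib)
  also have "(\<Sum>i\<in>I - {i0}. if i \<in> u then b i0 * y i else 0) = (\<Sum>i\<in>(I - {i0}) \<inter> u. b i0 * y i)"
    using I by (subst sum.inter_restrict) auto
  also have "(I - {i0}) \<inter> u = u - {i0}" using u by auto
  also have "(\<Sum>i\<in>u - {i0}. b i0 * y i) = b i0 * y i0" by (simp add: y sum_distrib_left)
  also have "(\<Sum>i\<in>I - {i0}. b i * y i) + b i0 * y i0 = (\<Sum>i\<in>I. b i * y i)"
    using sum.remove[of I i0 "\<lambda>i. b i * y i"] I u by (auto simp: add.commute)
  finally show ?thesis by simp
qed

definition injective_matrix :: "nat \<Rightarrow> (nat \<Rightarrow> nat \<Rightarrow> bit) \<Rightarrow> bool" where
  "injective_matrix m D \<longleftrightarrow>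
     (\<forall>w. (\<forall>l\<in>{1..m}. (\<Sum>c\<in>{1..m}. D l c * w c) = 0) \<longrightarrow> (\<forall>c\<in>{1..m}. w c = 0))"

lemma f2_nonsingular_imp_injective:
  assumes "f2_nonsingular m D"
  shows "injective_matrix m (\<lambda>l c. of_nat (D l c))"
  unfolding injective_matrix_def
proof (intro allI impI ballI)
  fix w :: "nat \<Rightarrow> bit" and p
  assume w: "\<forall>l\<in>{1..m}. (\<Sum>c\<in>{1..m}. of_nat (D l c) * w c) = 0" and p: "p \<in> {1..m}"
  from assms obtain E where
    E: "\<forall>i\<in>{1..m}. \<forall>c\<in>{1..m}. (\<Sum>l\<in>{1..m}. E i l * D l c) mod 2 = (if i = c then 1 else 0)"
    unfolding f2_nonsingular_def by blast
  have ED: "(\<Sum>l\<in>{1..m}. of_nat (E p l) * of_nat (D l c)) = (if p = c then 1 else 0 :: bit)"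
    if "c \<in> {1..m}" for c
    using E p that unfolding mod2_eq_iff_of_nat_bit of_nat_sum of_nat_mult by blast
  have "0 = (\<Sum>l\<in>{1..m}. of_nat (E p l) * (\<Sum>c\<in>{1..m}. of_nat (D l c) * w c))"
    using w by simp
  also have "\<dots> = (\<Sum>c\<in>{1..m}. (\<Sum>l\<in>{1..m}. of_nat (E p l) * of_nat (D l c)) * w c)"
    unfolding sum_distrib_left sum_distrib_right by (subst sum.swap) (simp add: mult.assoc)
  also have "\<dots> = (\<Sum>c\<in>{1..m}. if p = c then w c else 0)"
    by (rule sum.cong[OF refl]) (simp add: ED)
  also have "\<dots> = w p" using p by simp
  finally show "w p = 0" by simp
qed

text \<open>As \<open>l0 > m\<close>, the conditions for row \<open>l0\<close> of component
  \<open>j0\<close> run over all columns \<open>l'\<close>. Injectivity of \<open>C j0\<close> then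
  forces the \<open>y (i, c)\<close> with \<open>i\<close> in \<open>u\<close> to sum to 0 for each
  \<open>c\<close>. Solving for \<open>y (i0, c)\<close> removes \<open>i0\<close> and adds its
  digits to the other indices in \<open>u\<close>.\<close>

lemma rel_prob_eliminate:
  fixes a :: "nat \<Rightarrow> nat \<Rightarrow> nat \<Rightarrow> bit"
  assumes I: "finite I" and inj: "injective_matrix m (C j0)"
    and i0: "i0 \<in> I" and j0: "j0 \<in> {1..s}" and l0: "l0 \<in> {1..n}" "m < l0" and a0: "a i0 j0 l0 = 1"
    and a': "\<And>i j l. a' i j l = (if a i j0 l0 = 1 then a i j l + a i0 j l else a i j l)"
  shows "rel_prob s m n C I a = rel_prob s m n C (I - {i0}) a'"
proof -
  define u where "u = {i \<in> I. a i j0 l0 = 1}"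
  have u: "u \<subseteq> I" "i0 \<in> u" "finite u" using i0 a0 I by (auto simp: u_def)
  define S where "S = {y \<in> cube (I \<times> {1..m}). \<forall>c\<in>{1..m}. (\<Sum>i\<in>u. y (i, c)) = 0}"
  define f where "f J b y = (if \<forall>j\<in>{1..s}. \<forall>l\<in>{1..n}. \<forall>l'\<in>{1..m} \<inter> {..<l}. row_form m C J b y j l l' = 0
     then chi (\<Sum>j\<in>{1..s}. \<Sum>l\<in>{1..n} \<inter> {..m}. row_form m C J b y j l l) else 0)" for J b y
  have u_sum: "(\<Sum>i\<in>u. y (i, c)) = 0 \<longleftrightarrow> y (i0, c) = (\<Sum>i\<in>u - {i0}. y (i, c))" for y :: "nat \<times> nat \<Rightarrow> bit" and c
    using u by (subst sum.remove[of u i0]) (auto simp: add_bit_eq_0_iff)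
  \<comment> \<open>Characters violating that relation contribute nothing.\<close>
  have out: "f I a y = 0" if "y \<in> cube (I \<times> {1..m}) - S" for y
  proof -
    have "\<not> (\<forall>l'\<in>{1..m}. row_form m C I a y j0 l0 l' = 0)"
    proof
      assume *: "\<forall>l'\<in>{1..m}. row_form m C I a y j0 l0 l' = 0"
      have "(\<Sum>i\<in>I. a i j0 l0 * y (i, c)) = (\<Sum>i\<in>u. y (i, c))" for c
      proof -
        have "(\<Sum>i\<in>I. a i j0 l0 * y (i, c)) = (\<Sum>i\<in>I. if a i j0 l0 = 1 then y (i, c) else 0)"
          by (intro sum.cong) auto
        also have "\<dots> = (\<Sum>i\<in>u. y (i, c))" unfolding u_def using I by (subst sum.inter_filter) auto
        finally show ?thesis .
      qed
      with * inj[unfolded injective_matrix_def, THEN spec, of "\<lambda>c. \<Sum>i\<in>u. y (i, c)"]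
      have "\<forall>c\<in>{1..m}. (\<Sum>i\<in>u. y (i, c)) = 0" by (simp add: row_form_def)
      with that show False by (simp add: S_def)
    qed
    then obtain l' where l': "l' \<in> {1..m}" "row_form m C I a y j0 l0 l' \<noteq> 0" by blast
    with l0 have "l' \<in> {1..m} \<inter> {..<l0}" by auto
    with l' have "\<not> (\<forall>j\<in>{1..s}. \<forall>l\<in>{1..n}. \<forall>l'\<in>{1..m} \<inter> {..<l}. row_form m C I a y j l l' = 0)"
      using j0 l0(1) by blast
    then show ?thesis unfolding f_def by (rule if_not_P)
  qed
  have form: "row_form m C I a y j l l' = row_form m C (I - {i0}) a' z j l l'"
    if y: "\<forall>c\<in>{1..m}. (\<Sum>i\<in>u. y (i, c)) = 0"
      and z: "\<And>i c. i \<in> I - {i0} \<Longrightarrow> c \<in> {1..m} \<Longrightarrow> z (i, c) = y (i, c)" for y z j l l'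
    unfolding row_form_def
  proof (rule sum.cong[OF refl], rule arg_cong2[where f="(*)", OF refl])
    fix c assume c: "c \<in> {1..m}"
    have "y (i0, c) = (\<Sum>i\<in>u - {i0}. y (i, c))" using y c by (simp add: u_sum)
    then have "(\<Sum>i\<in>I. a i j l * y (i, c)) =
        (\<Sum>i\<in>I - {i0}. (if i \<in> u then a i j l + a i0 j l else a i j l) * y (i, c))"
      by (rule sum_eliminate_index[OF I u(1,2), where y="\<lambda>i. y (i, c)"])
    also have "\<dots> = (\<Sum>i\<in>I - {i0}. a' i j l * z (i, c))"
      using z c by (intro sum.cong refl) (auto simp: a' u_def)
    finally show "(\<Sum>i\<in>I. a i j l * y (i, c)) = (\<Sum>i\<in>I - {i0}. a' i j l * z (i, c))" .
  qed
  have "rel_prob s m n C I a = (\<Sum>y\<in>cube (I \<times> {1..m}). f I a y)"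
    by (simp add: rel_prob_def f_def)
  also have "\<dots> = (\<Sum>y\<in>S. f I a y)"
    by (rule sum.mono_neutral_right) (use I out in \<open>auto simp: S_def\<close>)
  \<comment> \<open>On \<open>S\<close>, forgetting the coordinates at \<open>i0\<close> is a
    bijection; the relation restores them.\<close>
  also have "\<dots> = (\<Sum>z\<in>cube ((I - {i0}) \<times> {1..m}). f (I - {i0}) a' z)"
  proof (rule sum.reindex_bij_witness[where
        j="\<lambda>y. restrict y ((I - {i0}) \<times> {1..m})" and
        i="\<lambda>z. \<lambda>x\<in>I \<times> {1..m}. if fst x = i0 then \<Sum>i\<in>u - {i0}. z (i, snd x) else z x"])
    fix y assume y: "y \<in> S"
    let ?z = "restrict y ((I - {i0}) \<times> {1..m})"
    show "?z \<in> cube ((I - {i0}) \<times> {1..m})" by auto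
    have "(\<lambda>x\<in>I \<times> {1..m}. if fst x = i0 then \<Sum>i\<in>u - {i0}. ?z (i, snd x) else ?z x) (i, c) = y (i, c)" for i c
    proof (cases "(i, c) \<in> I \<times> {1..m}")
      case True
      have "(\<Sum>i\<in>u - {i0}. ?z (i, c)) = (\<Sum>i\<in>u - {i0}. y (i, c))"
        using True u(1) by (intro sum.cong) auto
      moreover have "y (i0, c) = (\<Sum>i\<in>u - {i0}. y (i, c))"
        using y True by (auto simp: S_def u_sum)
      ultimately show ?thesis using True by auto
    next
      case False
      then show ?thesis using y by (auto simp: S_def PiE_def extensional_def)
    qed
    then show "(\<lambda>x\<in>I \<times> {1..m}. if fst x = i0 then \<Sum>i\<in>u - {i0}. ?z (i, snd x) else ?z x) = y" by auto
    show "f (I - {i0}) a' ?z = f I a y"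
    proof -
      have "row_form m C I a y j l l' = row_form m C (I - {i0}) a' ?z j l l'" for j l l'
        using y by (intro form) (auto simp: S_def)
      then show ?thesis by (simp add: f_def)
    qed
  next
    fix z assume z: "z \<in> cube ((I - {i0}) \<times> {1..m})"
    let ?y = "\<lambda>x\<in>I \<times> {1..m}. if fst x = i0 then \<Sum>i\<in>u - {i0}. z (i, snd x) else z x"
    have "?y (i0, c) = (\<Sum>i\<in>u - {i0}. ?y (i, c))" if "c \<in> {1..m}" for c
    proof -
      have "(\<Sum>i\<in>u - {i0}. ?y (i, c)) = (\<Sum>i\<in>u - {i0}. z (i, c))"
        using u(1) that by (intro sum.cong) auto
      then show ?thesis using i0 that by simp
    qed
    then have "\<forall>c\<in>{1..m}. (\<Sum>i\<in>u. ?y (i, c)) = 0" unfolding u_sum by blast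
    then show "?y \<in> S" unfolding S_def by auto
    show "restrict ?y ((I - {i0}) \<times> {1..m}) = z"
    proof
      fix x
      show "restrict ?y ((I - {i0}) \<times> {1..m}) x = z x"
        using PiE_arb[OF z, of x] by (cases "x \<in> (I - {i0}) \<times> {1..m}") auto
    qed
  qed
  also have "\<dots> = rel_prob s m n C (I - {i0}) a'" by (simp add: rel_prob_def f_def)
  finally show ?thesis .
qed

text \<open>A relation for the reduced family extends to one for \<open>a\<close> by giving
  \<open>i0\<close> the sum of the coefficients of the rest of \<open>u\<close>.\<close>

lemma f2_free_eliminate:
  fixes a :: "nat \<Rightarrow> nat \<Rightarrow> nat \<Rightarrow> bit"
  assumes I: "finite I" and free: "f2_free s n I a" and i0: "i0 \<in> I" "a i0 j0 l0 = 1"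
    and a': "\<And>i j l. a' i j l = (if a i j0 l0 = 1 then a i j l + a i0 j l else a i j l)"
  shows "f2_free s n (I - {i0}) a'"
  unfolding f2_free_def
proof (intro allI impI)
  fix y assume y: "\<forall>j\<in>{1..s}. \<forall>l\<in>{1..n}. (\<Sum>i\<in>I - {i0}. a' i j l * y i) = 0"
  define u where "u = {i \<in> I. a i j0 l0 = 1}"
  define z where "z = y(i0 := \<Sum>i\<in>u - {i0}. y i)"
  have z0: "z i0 = (\<Sum>i\<in>u - {i0}. z i)" by (auto simp: z_def intro!: sum.cong)
  have "(\<Sum>i\<in>I. a i j l * z i) = (\<Sum>i\<in>I - {i0}. a' i j l * y i)" for j l
  proof -
    have "(\<Sum>i\<in>I. a i j l * z i) =
        (\<Sum>i\<in>I - {i0}. (if i \<in> u then a i j l + a i0 j l else a i j l) * z i)"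
      using i0 by (intro sum_eliminate_index[OF I _ _ z0]) (auto simp: u_def)
    also have "\<dots> = (\<Sum>i\<in>I - {i0}. a' i j l * y i)"
      by (intro sum.cong refl) (auto simp: a' u_def z_def)
    finally show ?thesis .
  qed
  with y free[unfolded f2_free_def, THEN spec, of z] have "\<forall>i\<in>I. z i = 0" by simp
  then show "\<forall>i\<in>I - {i0}. y i = 0" by (auto simp: z_def split: if_splits)
qed

text \<open>While a digit beyond \<open>m\<close> remains, its index is eliminated; once none is
  left, rows beyond \<open>m\<close> contribute nothing and \<open>n\<close> drops to
  \<open>m\<close>. The normalisation of \<open>rel_prob\<close> absorbs the factor
  \<open>2 ^ (- m)\<close> of each step.\<close>

lemma rel_prob_reduce:
  assumes "finite I" "f2_free s n I a" "m \<le> n" "\<forall>j\<in>{1..s}. injective_matrix m (C j)"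
  shows "\<exists>J b. J \<subseteq> I \<and> f2_free s m J b \<and> rel_prob s m n C I a = rel_prob s m m C J b"
  using assms(1,2)
proof (induction "card I" arbitrary: I a rule: less_induct)
  case less
  show ?case
  proof (cases "\<exists>i\<in>I. \<exists>j\<in>{1..s}. \<exists>l\<in>{1..n}. m < l \<and> a i j l = 1")
    case True
    then obtain i0 j0 l0 where *: "i0 \<in> I" "j0 \<in> {1..s}" "l0 \<in> {1..n}" "m < l0" "a i0 j0 l0 = 1" by blast
    define a' where "a' i j l = (if a i j0 l0 = 1 then a i j l + a i0 j l else a i j l)" for i j l
    have "card (I - {i0}) < card I" using less.prems(1) *(1) by (metis card_Diff1_less)
    moreover have "f2_free s n (I - {i0}) a'"
      by (rule f2_free_eliminate[OF less.prems *(1,5)]) (simp add: a'_def)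
    ultimately obtain J b where "J \<subseteq> I - {i0}" "f2_free s m J b"
        "rel_prob s m n C (I - {i0}) a' = rel_prob s m m C J b"
      using less.hyps[of "I - {i0}" a'] less.prems(1) by auto
    moreover have "rel_prob s m n C I a = rel_prob s m n C (I - {i0}) a'"
      using assms(4) *(2) by (intro rel_prob_eliminate[where a=a and ?i0.0=i0 and ?j0.0=j0 and ?l0.0=l0, OF less.prems(1) _ *]) (auto simp: a'_def)
    ultimately show ?thesis by (intro exI[of _ J] exI[of _ b]) auto
  next
    case False
    then have zero: "a i j l = 0" if "i \<in> I" "j \<in> {1..s}" "l \<in> {1..n}" "m < l" for i j l
      using that by (metis bit_not_zero_iff)
    have "f2_free s m I a"
      unfolding f2_free_def
    proof (intro allI impI)
      fix y assume y: "\<forall>j\<in>{1..s}. \<forall>l\<in>{1..m}. (\<Sum>i\<in>I. a i j l * y i) = 0"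
      have "(\<Sum>i\<in>I. a i j l * y i) = 0" if "j \<in> {1..s}" "l \<in> {1..n}" for j l
        using y that zero[of _ j l] by (cases "l \<le> m") (auto simp: not_le intro!: sum.neutral)
      then show "\<forall>i\<in>I. y i = 0" using less.prems(2)[unfolded f2_free_def, THEN spec, of y] by simp
    qed
    moreover have "rel_prob s m n C I a = rel_prob s m m C I a"
      unfolding rel_prob_def
    proof (rule sum.cong[OF refl])
      fix y
      have form0: "row_form m C I a y j l l' = 0" if "j \<in> {1..s}" "l \<in> {1..n}" "m < l" for j l l'
        using zero that by (simp add: row_form_def)
      have "(\<forall>j\<in>{1..s}. \<forall>l\<in>{1..n}. \<forall>l'\<in>{1..m} \<inter> {..<l}. row_form m C I a y j l l' = 0) \<longleftrightarrow>
          (\<forall>j\<in>{1..s}. \<forall>l\<in>{1..m}. \<forall>l'\<in>{1..m} \<inter> {..<l}. row_form m C I a y j l l' = 0)"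
        (is "?L \<longleftrightarrow> ?R")
      proof
        assume ?L then show ?R using assms(3) by simp
      next
        assume R: ?R
        show ?L
        proof (intro ballI)
          fix j l l' assume "j \<in> {1..s}" "l \<in> {1..n}" "l' \<in> {1..m} \<inter> {..<l}"
          then show "row_form m C I a y j l l' = 0"
            using R form0[of j l l'] by (cases "l \<le> m") auto
        qed
      qed
      moreover have "{1..n} \<inter> {..m} = {1..m} \<inter> {..m}" using assms(3) by auto
      ultimately show "(if \<forall>j\<in>{1..s}. \<forall>l\<in>{1..n}. \<forall>l'\<in>{1..m} \<inter> {..<l}. row_form m C I a y j l l' = 0
         then chi (\<Sum>j\<in>{1..s}. \<Sum>l\<in>{1..n} \<inter> {..m}. row_form m C I a y j l l) else 0) =
        (if \<forall>j\<in>{1..s}. \<forall>l\<in>{1..m}. \<forall>l'\<in>{1..m} \<inter> {..<l}. row_form m C I a y j l l' = 0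
         then chi (\<Sum>j\<in>{1..s}. \<Sum>l\<in>{1..m} \<inter> {..m}. row_form m C I a y j l l) else 0)"
        by (simp only: )
    qed
    ultimately show ?thesis by blast
  qed
qed

subsection \<open>Markov's inequality and the union bound\<close>

abbreviation bit_tuple :: "(nat \<Rightarrow> nat \<Rightarrow> nat \<Rightarrow> nat) \<Rightarrow> nat \<Rightarrow> nat \<Rightarrow> nat \<Rightarrow> bit" where
  "bit_tuple Cg \<equiv> \<lambda>j l c. of_nat (Cg j l c)"

lemma rel_prob_cong_matrices:
  assumes "\<And>j l c. j \<in> {1..s} \<Longrightarrow> l \<in> {1..m} \<Longrightarrow> c \<in> {1..m} \<Longrightarrow> C j l c = C' j l c"
  shows "rel_prob s m m C I a = rel_prob s m m C' I a"
proof -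
  have "row_form m C I a y j l l' = row_form m C' I a y j l l'" if "j \<in> {1..s}" "l' \<in> {1..m}" for y j l l'
    using assms that by (auto simp: row_form_def intro!: sum.cong)
  then show ?thesis unfolding rel_prob_def
    by (intro sum.cong refl if_cong ball_cong arg_cong[where f=chi]) simp_all
qed

text \<open>The nonsingular tuples embed into all bit tuples, and the omitted terms are
  nonnegative.\<close>

lemma sum_rel_prob_gen_tuples_le:
  assumes I: "finite I" and free: "f2_free s m I a"
  shows "(\<Sum>Cg\<in>gen_tuples s m. rel_prob s m m (bit_tuple Cg) I a) \<le> 2 ^ (s * m * m)"
proof -
  let ?X = "{1..s} \<times> {1..m} \<times> {1..m}"
  define \<phi> where "\<phi> Cg = (\<lambda>x\<in>?X. bit_tuple Cg (fst x) (fst (snd x)) (snd (snd x)))" for Cg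
  let ?f = "\<lambda>D. rel_prob s m m (\<lambda>j l c. D (j, l, c)) I a"
  have "inj_on \<phi> (gen_tuples s m)"
  proof (rule inj_onI, intro ext)
    fix Cg Cg' j l c
    assume G: "Cg \<in> gen_tuples s m" "Cg' \<in> gen_tuples s m" and eq: "\<phi> Cg = \<phi> Cg'"
    show "Cg j l c = Cg' j l c"
    proof (cases "j \<in> {1..s}")
      case j: True
      then have mat: "f2_mat m (Cg j)" "f2_mat m (Cg' j)"
        using G by (auto simp: gen_tuples_def f2_nonsingular_def)
      show ?thesis
      proof (cases "l \<in> {1..m} \<and> c \<in> {1..m}")
        case True
        then have "(of_nat (Cg j l c) :: bit) = of_nat (Cg' j l c)"
          using fun_cong[OF eq, of "(j, l, c)"] j by (simp add: \<phi>_def)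
        moreover have "Cg j l c \<in> {0, 1}" "Cg' j l c \<in> {0, 1}" using mat unfolding f2_mat_def by blast+
        ultimately show ?thesis by auto
      next
        case False
        then show ?thesis using mat unfolding f2_mat_def by metis
      qed
    next
      case False
      then show ?thesis using G unfolding gen_tuples_def by auto
    qed
  qed
  moreover have "rel_prob s m m (bit_tuple Cg) I a = ?f (\<phi> Cg)" for Cg
    by (rule rel_prob_cong_matrices) (simp add: \<phi>_def)
  ultimately have "(\<Sum>Cg\<in>gen_tuples s m. rel_prob s m m (bit_tuple Cg) I a) = (\<Sum>D\<in>\<phi> ` gen_tuples s m. ?f D)"
    by (simp add: sum.reindex)
  also have "\<dots> \<le> (\<Sum>D\<in>cube ?X. ?f D)"
  proof (rule sum_mono2)
    show "\<phi> ` gen_tuples s m \<subseteq> cube ?X" unfolding \<phi>_def by (intro image_subsetI restrict_PiE_iff[THEN iffD2]) simp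
  qed (simp_all add: rel_prob_nonneg[OF I])
  also have "\<dots> = 2 ^ (s * m * m)" by (rule sum_rel_prob[OF I free])
  finally show ?thesis .
qed

definition bad_tuples :: "nat \<Rightarrow> nat \<Rightarrow> nat set \<Rightarrow> real \<Rightarrow> (nat \<Rightarrow> nat \<Rightarrow> nat \<Rightarrow> nat) set" where
  "bad_tuples s m I t = {Cg \<in> gen_tuples s m. \<exists>a. f2_free s m I a \<and> t < rel_prob s m m (bit_tuple Cg) I a}"

text \<open>One representative family is chosen for each attained value of \<open>top_rows\<close>.
  Markov's inequality bounds the tuples that are bad for one representative, and the number of
  values is at most \<open>m + 1\<close> to the number of pairs \<open>(j, u)\<close>.\<close>

lemma card_bad_tuples_le:
  assumes I: "finite I" and t: "0 \<le> t"
  shows "real (card (bad_tuples s m I t)) * t \<le> (real m + 1) ^ (s * (2 ^ card I - 1)) * 2 ^ (s * m * m)"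
proof -
  define F where "F = {a. f2_free s m I a}"
  define K where "K = top_rows s m I ` F"
  define rep where "rep = inv_into F (top_rows s m I)"
  let ?P = "PiE ({1..s} \<times> (Pow I - {{}})) (\<lambda>_. {..m})"
  have finP: "finite ?P" using I by (intro finite_PiE) auto
  have KP: "K \<subseteq> ?P" unfolding K_def using top_rows_range by blast
  have finK: "finite K" by (rule finite_subset[OF KP finP])
  have rep: "f2_free s m I (rep \<kappa>)" "top_rows s m I (rep \<kappa>) = \<kappa>" if "\<kappa> \<in> K" for \<kappa>
    using inv_into_into[of \<kappa> "top_rows s m I" F] f_inv_into_f[of \<kappa> "top_rows s m I" F] that
    unfolding K_def rep_def F_def by auto
  define B where "B \<kappa> = {Cg \<in> gen_tuples s m. t < rel_prob s m m (bit_tuple Cg) I (rep \<kappa>)}" for \<kappa>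
  have finB: "finite (B \<kappa>)" for \<kappa> unfolding B_def using finite_gen_tuples by simp
  have "bad_tuples s m I t \<subseteq> (\<Union>\<kappa>\<in>K. B \<kappa>)"
  proof
    fix Cg assume "Cg \<in> bad_tuples s m I t"
    then obtain a where a: "Cg \<in> gen_tuples s m" "a \<in> F" "t < rel_prob s m m (bit_tuple Cg) I a"
      unfolding bad_tuples_def F_def by blast
    have \<kappa>: "top_rows s m I a \<in> K" using a(2) by (simp add: K_def)
    then have "rel_prob s m m (bit_tuple Cg) I (rep (top_rows s m I a)) = rel_prob s m m (bit_tuple Cg) I a"
      by (intro rel_prob_cong_top_rows[OF I] rep(2))
    with a have "Cg \<in> B (top_rows s m I a)" unfolding B_def by simp
    with \<kappa> show "Cg \<in> (\<Union>\<kappa>\<in>K. B \<kappa>)" by blast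
  qed
  then have "card (bad_tuples s m I t) \<le> card (\<Union>\<kappa>\<in>K. B \<kappa>)"
    by (rule card_mono[rotated]) (use finK finB in auto)
  also have "\<dots> \<le> (\<Sum>\<kappa>\<in>K. card (B \<kappa>))" by (rule card_UN_le[OF finK])
  finally have "real (card (bad_tuples s m I t)) \<le> (\<Sum>\<kappa>\<in>K. real (card (B \<kappa>)))"
    by (metis of_nat_le_iff of_nat_sum)
  then have "real (card (bad_tuples s m I t)) * t \<le> (\<Sum>\<kappa>\<in>K. real (card (B \<kappa>)) * t)"
    using t by (simp add: mult_right_mono flip: sum_distrib_right)
  also have "\<dots> \<le> (\<Sum>\<kappa>\<in>K. 2 ^ (s * m * m))"
  proof (rule sum_mono)
    fix \<kappa> assume \<kappa>: "\<kappa> \<in> K"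
    have "real (card (B \<kappa>)) * t = (\<Sum>Cg\<in>B \<kappa>. t)" by simp
    also have "\<dots> \<le> (\<Sum>Cg\<in>B \<kappa>. rel_prob s m m (bit_tuple Cg) I (rep \<kappa>))"
      by (rule sum_mono) (auto simp: B_def)
    also have "\<dots> \<le> (\<Sum>Cg\<in>gen_tuples s m. rel_prob s m m (bit_tuple Cg) I (rep \<kappa>))"
      by (rule sum_mono2) (use finite_gen_tuples rel_prob_nonneg[OF I] in \<open>auto simp: B_def\<close>)
    also have "\<dots> \<le> 2 ^ (s * m * m)" by (rule sum_rel_prob_gen_tuples_le[OF I rep(1)[OF \<kappa>]])
    finally show "real (card (B \<kappa>)) * t \<le> 2 ^ (s * m * m)" .
  qed
  also have "\<dots> = real (card K) * 2 ^ (s * m * m)" by simp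
  also have "real (card K) \<le> (real m + 1) ^ (s * (2 ^ card I - 1))"
  proof -
    have "card K \<le> card ?P" by (rule card_mono[OF finP KP])
    also have "\<dots> = (m + 1) ^ (s * (2 ^ card I - 1))"
      using I by (subst card_PiE) (auto simp: card_cartesian_product card_Diff_subset card_Pow One_nat_def)
    finally have "real (card K) \<le> real ((m + 1) ^ (s * (2 ^ card I - 1)))" by (simp only: of_nat_le_iff)
    then show ?thesis by (simp add: add.commute)
  qed
  finally show ?thesis by (simp add: mult_right_mono)
qed

subsection \<open>Families of linearly independent indices\<close>

text \<open>A digit \<open>l\<close> of \<open>k\<close> forces \<open>2 ^ (l - 1)\<close> to be at
  most \<open>k\<close>. This crude bound suffices to find a common \<open>n\<close>.\<close>

lemma digits_subset: "digits k \<subseteq> {1..k}"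
proof
  fix l assume "l \<in> digits k"
  then have l: "1 \<le> l" "odd (k div 2 ^ (l - 1))" by (auto simp: digits_def bit_iff_odd)
  have "2 ^ (l - 1) \<le> k"
  proof (rule ccontr)
    assume "\<not> 2 ^ (l - 1) \<le> k"
    then have "k div 2 ^ (l - 1) = 0" by simp
    with l show False by simp
  qed
  with less_exp have "l - 1 < k" by (rule less_le_trans)
  with l(1) show "l \<in> {1..k}" by simp
qed

lemma xor_sum_insert:
  assumes "finite W" "k \<notin> W"
  shows "xor_sum (insert k W) = (\<lambda>j. xor (k j) (xor_sum W j))"
proof -
  interpret comp_fun_commute "\<lambda>(k :: nat \<Rightarrow> nat) acc j. xor (k j) (acc j)"
    by standard (auto simp: fun_eq_iff xor.left_commute)
  show ?thesis unfolding xor_sum_def by (rule fold_insert[OF assms])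
qed

lemma bit_xor_sum:
  assumes "finite W"
  shows "(of_bool (bit (xor_sum W j) p) :: bit) = (\<Sum>k\<in>W. of_bool (bit (k j) p))"
  using assms
proof (induction W rule: finite_induct)
  case empty
  show ?case by (simp add: xor_sum_def)
next
  case (insert k W)
  have "(of_bool (b \<noteq> c) :: bit) = of_bool b + of_bool c" for b c by auto
  with insert show ?case by (simp add: xor_sum_insert bit_xor_iff)
qed

text \<open>The maximum defining the rank is attained by a subset as large as \<open>V\<close>,
  hence by \<open>V\<close> itself.\<close>

lemma Vr_imp_f2_indep:
  assumes "V \<in> Vr s r"
  shows "f2_indep V"
proof -
  have V: "finite V" "card V = r" "f2_rank V = r" using assms by (auto simp: Vr_def)
  have "f2_rank V \<in> {card W | W. W \<subseteq> V \<and> f2_indep W}"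
    unfolding f2_rank_def
  proof (rule Max_in)
    have "{card W | W. W \<subseteq> V \<and> f2_indep W} \<subseteq> card ` Pow V" by auto
    then show "finite {card W | W. W \<subseteq> V \<and> f2_indep W}" by (rule finite_subset) (simp add: V(1))
    show "{card W | W. W \<subseteq> V \<and> f2_indep W} \<noteq> {}"
      by (auto simp: f2_indep_def intro!: exI[of _ "{}"])
  qed
  then obtain W where "W \<subseteq> V" "f2_indep W" "card W = r" using V(3) by auto
  with V show ?thesis by (metis card_subset_eq)
qed

text \<open>The support \<open>U\<close> of a nontrivial relation would be a nonempty set of indices
  whose XOR has all digits zero, contradicting independence of \<open>V\<close>.\<close>

lemma Vr_imp_f2_free:
  assumes V: "V \<in> Vr s r"
  obtains k n where "V = k ` {..<r}" "m \<le> n"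
    "\<And>i j. i \<in> {..<r} \<Longrightarrow> j \<in> {1..s} \<Longrightarrow> digits (k i j) \<subseteq> {1..n}"
    "f2_free s n {..<r} (digit_family k)"
proof -
  have fin: "finite V" "card V = r" and sub: "V \<subseteq> kvecs_star s" using V by (auto simp: Vr_def)
  obtain k where k: "bij_betw k {..<r} V"
    using ex_bij_betw_nat_finite[OF fin(1)] fin(2) by (auto simp: atLeast0LessThan)
  then have kV: "V = k ` {..<r}" and kinj: "inj_on k {..<r}" by (auto simp: bij_betw_def)
  \<comment> \<open>The sum of all components bounds every digit position, and the summand
    \<open>m\<close> ensures \<open>m \<le> n\<close>.\<close>
  define n where "n = m + (\<Sum>i<r. \<Sum>j\<in>{1..s}. k i j)"
  have dig: "digits (k i j) \<subseteq> {1..n}" if "i \<in> {..<r}" "j \<in> {1..s}" for i j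
  proof -
    have "k i j \<le> (\<Sum>j\<in>{1..s}. k i j)" by (rule member_le_sum) (use that in auto)
    also have "\<dots> \<le> (\<Sum>i<r. \<Sum>j\<in>{1..s}. k i j)" by (rule member_le_sum) (use that in auto)
    finally show ?thesis using digits_subset[of "k i j"] by (auto simp: n_def)
  qed
  have "f2_free s n {..<r} (digit_family k)"
    unfolding f2_free_def
  proof (intro allI impI, rule ccontr)
    fix y
    assume y: "\<forall>j\<in>{1..s}. \<forall>l\<in>{1..n}. (\<Sum>i<r. digit_family k i j l * y i) = 0"
      and not0: "\<not> (\<forall>i\<in>{..<r}. y i = 0)"
    define U where "U = {i \<in> {..<r}. y i = 1}"
    have U: "U \<noteq> {}" "finite U" "U \<subseteq> {..<r}" using not0 by (auto simp: U_def)
    then have "k ` U \<subseteq> V" "k ` U \<noteq> {}" by (auto simp: kV)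
    then have "xor_sum (k ` U) \<noteq> (\<lambda>_. 0)" using Vr_imp_f2_indep[OF V] by (auto simp: f2_indep_def)
    then obtain j where "xor_sum (k ` U) j \<noteq> 0" by auto
    then obtain p where p: "bit (xor_sum (k ` U) j) p" by (auto simp: bit_eq_iff)
    have "1 = (\<Sum>k\<in>k ` U. of_bool (bit (k j) p) :: bit)"
      using bit_xor_sum[of "k ` U" j p] U(2) p by simp
    also have "\<dots> = (\<Sum>i\<in>U. of_bool (bit (k i j) p))"
      using inj_on_subset[OF kinj U(3)] by (simp add: sum.reindex)
    finally have one: "(\<Sum>i\<in>U. of_bool (bit (k i j) p)) = (1 :: bit)" ..
    have "\<exists>i\<in>U. bit (k i j) p"
    proof (rule ccontr)
      assume "\<not> (\<exists>i\<in>U. bit (k i j) p)"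
      then have "(\<Sum>i\<in>U. of_bool (bit (k i j) p)) = (0 :: bit)" by (intro sum.neutral) simp
      with one show False by simp
    qed
    then obtain i where i: "i \<in> U" "bit (k i j) p" by blast
    have "j \<in> {1..s}"
    proof (rule ccontr)
      assume "j \<notin> {1..s}"
      moreover have "k i \<in> kvecs s" using i(1) U(3) kV sub by (auto simp: kvecs_star_def)
      ultimately have "k i j = 0" by (auto simp: kvecs_def)
      with i show False by simp
    qed
    \<comment> \<open>Bits are counted from 0 and digits from 1, so bit \<open>p\<close> is digit
      \<open>Suc p\<close>.\<close>
    moreover have "Suc p \<in> {1..n}"
    proof -
      have "Suc p \<in> digits (k i j)" using i(2) by (simp add: digits_def)
      then show ?thesis using dig[of i j] i(1) U(3) \<open>j \<in> {1..s}\<close> by blast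
    qed
    ultimately have "(\<Sum>i<r. digit_family k i j (Suc p) * y i) = 0" using y by blast
    also have "(\<Sum>i<r. digit_family k i j (Suc p) * y i) =
        (\<Sum>i\<in>{..<r}. if y i = 1 then of_bool (bit (k i j) p) else 0)"
      by (intro sum.cong) (auto simp: digit_family_def digits_def)
    also have "\<dots> = (\<Sum>i\<in>U. of_bool (bit (k i j) p))"
      unfolding U_def by (subst sum.inter_filter) auto
    finally show False using one by simp
  qed
  then show ?thesis using that[of k n] kV dig by (simp add: n_def)
qed

section \<open>From a large rank deficiency to the tail bound\<close>

lemma rel_prob_empty: "rel_prob s m n C {} a = 1"
  by (simp add: rel_prob_def row_form_def)

text \<open>The strict inequality \<open>log 2 t < T\<close> yields a single \<open>V\<close> in the
  supremum whose relative probability exceeds \<open>t\<close>. The reduction moves it to a family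
  on some \<open>J\<close> with digits up to \<open>m\<close>; \<open>J\<close> is nonempty because
  the empty family has value 1, which is at most \<open>t\<close>.\<close>

lemma large_rank_def_imp_bad:
  assumes Cg: "Cg \<in> gen_tuples s m" and t: "1 \<le> t" "log 2 t < T" and T: "ereal T \<le> rank_def s m r Cg"
  shows "\<exists>I\<in>Pow {..<r} - {{}}. Cg \<in> bad_tuples s m I t"
proof -
  have "ereal (log 2 t) < ereal (real (m * r)) + (SUP V\<in>Vr s r. elog2 (Pr_all s m Cg V))"
    using t(2) T unfolding rank_def_def by (meson ereal_less_eq(3) less_ereal.simps(1) less_le_trans)
  then have "ereal (log 2 t - real (m * r)) < (SUP V\<in>Vr s r. elog2 (Pr_all s m Cg V))"
    by (cases "SUP V\<in>Vr s r. elog2 (Pr_all s m Cg V)") (auto simp: algebra_simps)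
  then obtain V where V: "V \<in> Vr s r" "ereal (log 2 t - real (m * r)) < elog2 (Pr_all s m Cg V)"
    by (auto simp: less_SUP_iff)
  let ?p = "Pr_all s m Cg V"
  have p0: "?p \<noteq> 0" and "log 2 t - real (m * r) < log 2 ?p"
    using V(2) by (auto simp: elog2_def split: if_splits)
  moreover have "0 < ?p" using p0 by (simp add: Pr_all_def measure_nonneg less_le)
  ultimately have "log 2 t < log 2 (2 ^ (m * r) * ?p)"
    by (simp add: log_mult log_nat_power)
  then have large: "t < 2 ^ (m * r) * ?p"
    using t(1) \<open>0 < ?p\<close> by (subst (asm) log_less_cancel_iff) auto
  obtain k n where kn: "V = k ` {..<r}" "m \<le> n"
    "\<And>i j. i \<in> {..<r} \<Longrightarrow> j \<in> {1..s} \<Longrightarrow> digits (k i j) \<subseteq> {1..n}"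
    "f2_free s n {..<r} (digit_family k)"
    using Vr_imp_f2_free[OF V(1), of m] by metis
  have "\<forall>j\<in>{1..s}. injective_matrix m (bit_tuple Cg j)"
    using Cg f2_nonsingular_imp_injective by (auto simp: gen_tuples_def)
  from rel_prob_reduce[OF _ kn(4,2) this] obtain J b where
    J: "J \<subseteq> {..<r}" "f2_free s m J b"
       "rel_prob s m n (bit_tuple Cg) {..<r} (digit_family k) = rel_prob s m m (bit_tuple Cg) J b"
    by auto
  have "2 ^ (m * r) * ?p = rel_prob s m n (bit_tuple Cg) {..<r} (digit_family k)"
    using Pr_all_eq_rel_prob[of "{..<r}" s k n m Cg, OF _ kn(3)] kn(1) by simp
  with large J(3) have "t < rel_prob s m m (bit_tuple Cg) J b" by simp
  moreover from this t(1) have "J \<noteq> {}" by (auto simp: rel_prob_empty)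
  ultimately show ?thesis using J(1,2) Cg unfolding bad_tuples_def by blast
qed

lemma rank_deficiency_tail:
  assumes s: "1 \<le> s" and m: "1 \<le> m" and r: "1 \<le> r"
  shows "measure_pmf.prob (pmf_of_set (gen_tuples s m))
      {Cg. ereal ((2 ^ r + 2 * real r - 1) * real s * log 2 (real m + 1)) \<le> rank_def s m r Cg}
    \<le> exp (2 * real s * real r) / (real m + 1) ^ (2 * s * r)"
proof -
  define G where "G = gen_tuples s m"
  define T where "T = (2 ^ r + 2 * real r - 1) * real s * log 2 (real m + 1)"
  define A where "A = {Cg \<in> G. ereal T \<le> rank_def s m r Cg}"
  define x where "x = real m + 1"
  \<comment> \<open>The number of pairs \<open>(j, u)\<close> for the full index set. The threshold
    equals the logarithm of \<open>x ^ (e + 2 * s * r)\<close>: the part \<open>x ^ e\<close> pays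
    for the union bound and \<open>x ^ (2 * s * r)\<close> remains.\<close>
  define e where "e = (2 ^ r - 1) * s"
  \<comment> \<open>The factor \<open>2 ^ r - 1\<close> counts the nonempty sets of indices that can
    survive the reduction.\<close>
  define K where "K = (2 ^ r - 1) * x ^ e * 4 ^ s * real (card G)"
  have x: "1 < x" using m by (simp add: x_def)
  have finG: "finite G" "G \<noteq> {}" using finite_gen_tuples gen_tuples_nonempty[OF m] by (auto simp: G_def)
  have real_e: "real e = (2 ^ r - 1) * real s" by (simp add: e_def of_nat_diff)
  have "(2 ^ r + 2 * real r - 1) * real s = real (e + 2 * s * r)"
    using real_e by (simp add: algebra_simps)
  then have "T = real (e + 2 * s * r) * log 2 x"
    by (simp only: T_def x_def)
  also have "\<dots> = log 2 (x ^ (e + 2 * s * r))" using x by (simp add: log_nat_power)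
  finally have T: "T = log 2 (x ^ (e + 2 * s * r))" .
  have below: "real (card A) * t \<le> K" if t: "1 \<le> t" "t < x ^ (e + 2 * s * r)" for t
  proof -
    have "log 2 t < T" using t unfolding T by (intro log_less) auto
    have "A \<subseteq> (\<Union>I\<in>Pow {..<r} - {{}}. bad_tuples s m I t)"
    proof
      fix Cg assume "Cg \<in> A"
      then have "\<exists>I\<in>Pow {..<r} - {{}}. Cg \<in> bad_tuples s m I t"
        using \<open>log 2 t < T\<close> t(1) by (intro large_rank_def_imp_bad[of _ _ _ _ T]) (simp_all add: A_def G_def)
      then show "Cg \<in> (\<Union>I\<in>Pow {..<r} - {{}}. bad_tuples s m I t)" by blast
    qed
    then have "card A \<le> card (\<Union>I\<in>Pow {..<r} - {{}}. bad_tuples s m I t)"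
      by (rule card_mono[rotated]) (use finite_gen_tuples in \<open>auto simp: bad_tuples_def\<close>)
    also have "\<dots> \<le> (\<Sum>I\<in>Pow {..<r} - {{}}. card (bad_tuples s m I t))"
      by (rule card_UN_le) simp
    finally have "real (card A) \<le> (\<Sum>I\<in>Pow {..<r} - {{}}. real (card (bad_tuples s m I t)))"
      by (metis of_nat_le_iff of_nat_sum)
    then have "real (card A) * t \<le> (\<Sum>I\<in>Pow {..<r} - {{}}. real (card (bad_tuples s m I t)) * t)"
      using t by (simp add: mult_right_mono flip: sum_distrib_right)
    also have "\<dots> \<le> (\<Sum>I\<in>Pow {..<r} - {{}}. x ^ e * (4 ^ s * real (card G)))"
    proof (rule sum_mono)
      fix I assume I: "I \<in> Pow {..<r} - {{}}"
      then have fin: "finite I" and "card I \<le> r" using card_mono[of "{..<r}" I] by (auto intro: finite_subset)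
      then have "(2::nat) ^ card I \<le> 2 ^ r" by (intro power_increasing) auto
      then have "s * (2 ^ card I - 1) \<le> e"
        unfolding e_def mult.commute[of _ s] by (intro mult_left_mono diff_le_mono) auto
      then have "x ^ (s * (2 ^ card I - 1)) \<le> x ^ e" using x by (intro power_increasing) auto
      then have "x ^ (s * (2 ^ card I - 1)) * 2 ^ (s * m * m) \<le> x ^ e * (4 ^ s * real (card G))"
        unfolding G_def using x by (intro mult_mono card_gen_tuples_ge[OF m]) auto
      moreover have "real (card (bad_tuples s m I t)) * t \<le> x ^ (s * (2 ^ card I - 1)) * 2 ^ (s * m * m)"
        using card_bad_tuples_le[OF fin, of t s m] t by (simp add: x_def)
      ultimately show "real (card (bad_tuples s m I t)) * t \<le> x ^ e * (4 ^ s * real (card G))" by simp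
    qed
    also have "\<dots> = K" by (simp add: K_def card_Diff_subset card_Pow of_nat_diff)
    finally show ?thesis .
  qed
  \<comment> \<open>Passing to the limit from below the threshold avoids showing that the supremum in the
    rank deficiency is attained.\<close>
  have lim: "real (card A) * x ^ (e + 2 * s * r) \<le> K"
  proof (rule ccontr)
    assume neg: "\<not> ?thesis"
    have "0 \<le> K" using x by (simp add: K_def)
    with neg have pos: "0 < real (card A)" by (cases "card A = 0") auto
    have "K / real (card A) < x ^ (e + 2 * s * r)" using neg pos by (simp add: field_simps)
    moreover have "1 < x ^ (e + 2 * s * r)" using x s r by (intro one_less_power) auto
    ultimately obtain t where "max 1 (K / real (card A)) < t" "t < x ^ (e + 2 * s * r)"
      using dense[of "max 1 (K / real (card A))" "x ^ (e + 2 * s * r)"] by auto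
    then have t: "1 \<le> t" "K / real (card A) < t" "t < x ^ (e + 2 * s * r)" by auto
    from t(2) pos have "K < real (card A) * t" by (simp add: field_simps)
    with below[OF t(1,3)] show False by simp
  qed
  have const: "(2 ^ r - 1) * 4 ^ s \<le> exp (2 * real s * real r)"
  proof -
    have e2: "(2::real) \<le> exp 1" using exp_ge_add_one_self[of 1] by simp
    have "(4::real) ^ s = 2 ^ (2 * s)" by (simp add: power_mult)
    also have "\<dots> \<le> exp 1 ^ (2 * s)" using e2 by (intro power_mono) auto
    finally have four: "(4::real) ^ s \<le> exp (2 * real s)" by (simp flip: exp_of_nat_mult)
    show ?thesis
    \<comment> \<open>For \<open>r = 1\<close> the first factor is 1. Otherwise it is at most
      \<open>exp r\<close>, and \<open>r + 2 * s \<le> 2 * s * r\<close> needs \<open>r\<close> to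
      be at least 2.\<close>
    proof (cases "r = 1")
      case True
      then show ?thesis using four by simp
    next
      case False
      have "(2::real) ^ r \<le> exp 1 ^ r" using e2 by (intro power_mono) auto
      then have "(2 ^ r - 1) * 4 ^ s \<le> exp (real r) * exp (2 * real s)"
        using four by (intro mult_mono) (simp_all flip: exp_of_nat_mult)
      also have "\<dots> \<le> exp (2 * real s * real r)"
      proof -
        have "1 * r \<le> s * r" using s by (intro mult_right_mono) auto
        moreover have "s * 2 \<le> s * r" using r False by (intro mult_left_mono) auto
        ultimately have "r + 2 * s \<le> 2 * s * r" unfolding mult.assoc by linarith
        then have "real (r + 2 * s) \<le> real (2 * s * r)" by (simp only: of_nat_le_iff)
        then show ?thesis by (simp flip: exp_add)
      qed
      finally show ?thesis .
    qed
  qed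
  have "measure_pmf.prob (pmf_of_set G) {Cg. ereal T \<le> rank_def s m r Cg} = real (card A) / real (card G)"
    using finG by (simp add: measure_pmf_of_set A_def Int_def)
  also have "\<dots> \<le> (2 ^ r - 1) * 4 ^ s / x ^ (2 * s * r)"
  proof -
    have g: "0 < real (card G)" using finG by (simp add: card_gt_0_iff)
    have "x ^ e * (real (card A) * x ^ (2 * s * r)) \<le> x ^ e * ((2 ^ r - 1) * 4 ^ s * real (card G))"
      using lim by (simp add: K_def power_add mult_ac)
    then have "real (card A) * x ^ (2 * s * r) \<le> (2 ^ r - 1) * 4 ^ s * real (card G)"
      using x by (subst (asm) mult_le_cancel_left_pos) auto
    then show ?thesis using g x by (simp add: field_simps)
  qed
  also have "\<dots> \<le> exp (2 * real s * real r) / x ^ (2 * s * r)"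
    using const x by (intro divide_right_mono) auto
  finally show ?thesis unfolding G_def T_def x_def .
qed

theorem theorem9:
  fixes s m :: nat
  assumes "1 \<le> s" and "1 \<le> m"
  shows "measure_pmf.prob (pmf_of_set (gen_tuples s m))
           {Cg. rank_def s m 1 Cg \<ge> ereal (3 * real s * log 2 (real m + 1))}
         \<le> exp (2 * real s) / (real m + 1) ^ (2 * s) \<and>
         (\<forall>r\<ge>2. measure_pmf.prob (pmf_of_set (gen_tuples s m))
           {Cg. rank_def s m r Cg \<ge> max (rank_def s m (r - 1) Cg)
                  (ereal ((2 ^ r + 2 * real r - 1) * real s * log 2 (real m + 1)))}
         \<le> exp (2 * real s * real r) / (real m + 1) ^ (2 * s * r))"
proof (intro conjI allI impI)
  show "measure_pmf.prob (pmf_of_set (gen_tuples s m))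
           {Cg. rank_def s m 1 Cg \<ge> ereal (3 * real s * log 2 (real m + 1))}
         \<le> exp (2 * real s) / (real m + 1) ^ (2 * s)"
    \<comment> \<open>At \<open>r = 1\<close> the coefficient \<open>2 ^ r + 2 * r - 1\<close> is
      3.\<close>
    using rank_deficiency_tail[OF assms, of 1] by simp
next
  fix r :: nat assume r: "2 \<le> r"
  let ?T = "ereal ((2 ^ r + 2 * real r - 1) * real s * log 2 (real m + 1))"
  have "measure_pmf.prob (pmf_of_set (gen_tuples s m))
      {Cg. rank_def s m r Cg \<ge> max (rank_def s m (r - 1) Cg) ?T}
    \<le> measure_pmf.prob (pmf_of_set (gen_tuples s m)) {Cg. ?T \<le> rank_def s m r Cg}"
    by (rule measure_pmf.finite_measure_mono) auto
  also have "\<dots> \<le> exp (2 * real s * real r) / (real m + 1) ^ (2 * s * r)"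
    by (rule rank_deficiency_tail[OF assms]) (use r in simp)
  finally show "measure_pmf.prob (pmf_of_set (gen_tuples s m))
      {Cg. rank_def s m r Cg \<ge> max (rank_def s m (r - 1) Cg) ?T}
    \<le> exp (2 * real s * real r) / (real m + 1) ^ (2 * s * r)" .
qed

end
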